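(* Fix $\lambda,\kappa\in\mathbf{k}$. The operad $\mathcal{ETD}_{\lambda,\kappa}$ of extended tridendriform algebras of weight $(\lambda,\kappa)$ is the tri-companion $\mathrm{TC}(\mathcal{ERB}_{\lambda,\kappa})$ of the operad $\mathcal{ERB}_{\lambda,\kappa}$ of extended Rota-Baxter algebras of weight $(\lambda,\kappa)$. More precisely, let $V=\mathbf{k}\{\prec,\succ,\bullet\}$ be the vector space with basis $\{\prec,\succ,\bullet\}$. For the operad homomorphism $$\Phi:\mathcal{F}(V)\to\mathcal{ERB}_{\lambda,\kappa},\quad \prec\,\mapsto\mu(\mathrm{id}\otimes\rho),\quad \succ\,\mapsto\mu(\rho\otimes\mathrm{id}),\quad \bullet\mapsto\mu,$$ we have $$\ker\Phi\cap(V^{\otimes 2}\oplus V^{\otimes 2})=\Lambda_{\mathrm{ETD},\lambda,\kappa}.$$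
   Context: $\mathbf{k}$ is a field of characteristic $0$. All operads are nonsymmetric (ns) operads of $\mathbf{k}$-vector spaces, with partial compositions $\circ_i$ and operadic unit $\mathrm{id}$. $\mathcal{F}(W)$ denotes the free ns operad on a graded vector space $W$; a vector space $V$ of binary operations is placed in arity $2$. Convention: for $V$ in arity $2$, $\mathcal{F}(V)_3=(V\circ_1V)\oplus(V\circ_2V)$ is identified with $V^{\otimes 2}\oplus V^{\otimes 2}$ so that a pair $\big(\sum_i\odot^{(1)}_i\otimes\odot^{(2)}_i,\ \sum_j\odot^{(3)}_j\otimes\odot^{(4)}_j\big)$ represents the relation $\sum_i(x\odot^{(1)}_iy)\odot^{(2)}_iz=\sum_jx\odot^{(3)}_j(y\odot^{(4)}_jz)$, i.e. the element $\sum_i\odot^{(2)}_i\circ_1\odot^{(1)}_i-\sum_j\odot^{(3)}_j\circ_2\odot^{(4)}_j$ of $\mathcal{F}(V)_3$. For a subspace $\Lambda\subseteq V^{\otimes2}\oplus V^{\otimes2}$, $(\Lambda)$ is the operadic ideal it generates and $\mathcal{P}(V,\Lambda):=\mathcal{F}(V)/(\Lambda)$. $\mathcal{ETD}_{\lambda,\kappa}:=\mathcal{P}(V,\Lambda_{\mathrm{ETD},\lambda,\kappa})$ with $V=\mathbf{k}\{\prec,\succ,\bullet\}$ and $\Lambda_{\mathrm{ETD},\lambda,\kappa}$ the span of $(\prec\otimes\prec,\ \prec\otimes\star_\lambda+\kappa\,\bullet\otimes\bullet)$, $(\succ\otimes\prec,\ \succ\otimes\prec)$, $(\star_\lambda\otimes\succ+\kappa\,\bullet\otimes\bullet,\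 \succ\otimes\succ)$, $(\succ\otimes\bullet,\ \succ\otimes\bullet)$, $(\prec\otimes\bullet,\ \bullet\otimes\succ)$, $(\bullet\otimes\prec,\ \bullet\otimes\prec)$, $(\bullet\otimes\bullet,\ \bullet\otimes\bullet)$, where $\star_\lambda=\prec+\succ+\lambda\,\bullet$. $\mathcal{ERB}_{\lambda,\kappa}$ is the quotient of the free ns operad on a unary generator $\rho$ and a binary generator $\mu$ by the operadic ideal generated by the associativity relation $\mu\circ_1\mu-\mu\circ_2\mu$ and $\mu(\rho\otimes\rho)-\rho(\mu(\mathrm{id}\otimes\rho))-\rho(\mu(\rho\otimes\mathrm{id}))-\lambda\rho(\mu(\mathrm{id}\otimes\mathrm{id}))-\kappa\mu(\mathrm{id}\otimes\mathrm{id})$. Here $\mu(\mathrm{id}\otimes\rho)=\mu\circ_2\rho$, $\mu(\rho\otimes\mathrm{id})=\mu\circ_1\rho$. Tri-companion: for an ns operad $\mathcal{Q}$ presented by one unary generator $\rho$ and one binary generator $\mu$, let $V=\mathbf{k}\{\prec,\succ,\bullet\}$ in arity $2$ and let $\Phi_{\mathcal{Q}}:\mathcal{F}(V)\to\mathcal{Q}$ be the operad homomorphism with $\prec\,\mapsto\mu(\mathrm{id}\otimes\rho)$, $\succ\,\mapsto\mu(\rho\otimes\mathrm{id})$, $\bullet\mapsto\mu$. The tri-companion of $\mathcal{Q}$ is $\mathrm{TC}(\mathcal{Q}):=\mathcal{F}(V)/\big(\ker\Phi_{\mathcal{Q}}\cap(V^{\otimes2}\oplus V^{\otimes2})\big)$.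 *)

theory Defs
  imports Complex_Main "HOL-Library.Poly_Mapping" "HOL-Library.Product_Plus" "HOL-Library.FuncSet"
begin

section \<open>Nonsymmetric operads of vector spaces, with partial compositions\<close>

text \<open>
  \<^term>\<open>op_comp P m n i x y\<close> stands for \<open>x \<circ>\<^sub>i y\<close>, where \<open>x\<close> has arity \<open>m\<close>, \<open>y\<close> has arity \<open>n\<close>, and
  \<open>1 \<le> i \<le> m\<close>. The operations carry the arities as arguments since the components
  of different arities need not be disjoint.
\<close>

record ('k, 'a) operad =
  op_space :: "nat \<Rightarrow> 'a set"
  op_zero :: "nat \<Rightarrow> 'a"
  op_add :: "nat \<Rightarrow> 'a \<Rightarrow> 'a \<Rightarrow> 'a"
  op_scale :: "nat \<Rightarrow> 'k \<Rightarrow> 'a \<Rightarrow> 'a"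
  op_comp :: "nat \<Rightarrow> nat \<Rightarrow> nat \<Rightarrow> 'a \<Rightarrow> 'a \<Rightarrow> 'a"
  op_id :: "'a"

locale ns_operad =
  fixes P :: "('k::field, 'a) operad"
  assumes zero_closed: "op_zero P n \<in> op_space P n"
    and add_closed: "x \<in> op_space P n \<Longrightarrow> y \<in> op_space P n \<Longrightarrow> op_add P n x y \<in> op_space P n"
    and scale_closed: "x \<in> op_space P n \<Longrightarrow> op_scale P n c x \<in> op_space P n"
    and add_assoc: "\<lbrakk>x \<in> op_space P n; y \<in> op_space P n; z \<in> op_space P n\<rbrakk>
      \<Longrightarrow> op_add P n (op_add P n x y) z = op_add P n x (op_add P n y z)"
    and add_commute: "x \<in> op_space P n \<Longrightarrow> y \<in> op_space P n \<Longrightarrow> op_add P n x y = op_add P n y x"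
    and add_zero: "x \<in> op_space P n \<Longrightarrow> op_add P n x (op_zero P n) = x"
    and add_minus: "x \<in> op_space P n \<Longrightarrow> op_add P n x (op_scale P n (-1) x) = op_zero P n"
    and scale_add: "x \<in> op_space P n \<Longrightarrow> y \<in> op_space P n
      \<Longrightarrow> op_scale P n c (op_add P n x y) = op_add P n (op_scale P n c x) (op_scale P n c y)"
    and add_scale: "x \<in> op_space P n
      \<Longrightarrow> op_scale P n (c + d) x = op_add P n (op_scale P n c x) (op_scale P n d x)"
    and scale_scale: "x \<in> op_space P n \<Longrightarrow> op_scale P n c (op_scale P n d x) = op_scale P n (c * d) x"
    and scale_one: "x \<in> op_space P n \<Longrightarrow> op_scale P n 1 x = x"
    and comp_closed: "\<lbrakk>x \<in> op_space P m; y \<in> op_space P n; 1 \<le> i; i \<le> m\<rbrakk>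
      \<Longrightarrow> op_comp P m n i x y \<in> op_space P (m + n - 1)"
    and comp_add_left: "\<lbrakk>x \<in> op_space P m; x' \<in> op_space P m; y \<in> op_space P n; 1 \<le> i; i \<le> m\<rbrakk>
      \<Longrightarrow> op_comp P m n i (op_add P m x x') y
        = op_add P (m + n - 1) (op_comp P m n i x y) (op_comp P m n i x' y)"
    and comp_add_right: "\<lbrakk>x \<in> op_space P m; y \<in> op_space P n; y' \<in> op_space P n; 1 \<le> i; i \<le> m\<rbrakk>
      \<Longrightarrow> op_comp P m n i x (op_add P n y y')
        = op_add P (m + n - 1) (op_comp P m n i x y) (op_comp P m n i x y')"
    and comp_scale_left: "\<lbrakk>x \<in> op_space P m; y \<in> op_space P n; 1 \<le> i; i \<le> m\<rbrakk>
      \<Longrightarrow> op_comp P m n i (op_scale P m c x) y = op_scale P (m + n - 1) c (op_comp P m n i x y)"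
    and comp_scale_right: "\<lbrakk>x \<in> op_space P m; y \<in> op_space P n; 1 \<le> i; i \<le> m\<rbrakk>
      \<Longrightarrow> op_comp P m n i x (op_scale P n c y) = op_scale P (m + n - 1) c (op_comp P m n i x y)"
    and comp_sequential: "\<lbrakk>x \<in> op_space P l; y \<in> op_space P m; z \<in> op_space P n;
        1 \<le> i; i \<le> l; 1 \<le> j; j \<le> m\<rbrakk>
      \<Longrightarrow> op_comp P (l + m - 1) n (i - 1 + j) (op_comp P l m i x y) z
        = op_comp P l (m + n - 1) i x (op_comp P m n j y z)"
    and comp_parallel: "\<lbrakk>x \<in> op_space P l; y \<in> op_space P m; z \<in> op_space P n;
        1 \<le> i; i < k; k \<le> l\<rbrakk>
      \<Longrightarrow> op_comp P (l + m - 1) n (k - 1 + m) (op_comp P l m i x y) z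
        = op_comp P (l + n - 1) m i (op_comp P l n k x z) y"
    and id_closed: "op_id P \<in> op_space P 1"
    and comp_id_left: "x \<in> op_space P n \<Longrightarrow> op_comp P 1 n 1 (op_id P) x = x"
    and comp_id_right: "\<lbrakk>x \<in> op_space P n; 1 \<le> i; i \<le> n\<rbrakk> \<Longrightarrow> op_comp P n 1 i x (op_id P) = x"

subsection \<open>Homomorphisms and kernels\<close>

text \<open>
  A homomorphism is a family of linear maps, one for each arity. Outside the components of the
  source, its values are fixed (by \<open>\<rightarrow>\<^sub>E\<close>), so that equality of homomorphisms is meaningful.
\<close>

definition operad_hom :: "('k, 'a) operad \<Rightarrow> ('k, 'b) operad \<Rightarrow> (nat \<Rightarrow> 'a \<Rightarrow> 'b) set" where
  "operad_hom P Q = {f.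
     (\<forall>n. f n \<in> op_space P n \<rightarrow>\<^sub>E op_space Q n) \<and>
     (\<forall>n. \<forall>x\<in>op_space P n. \<forall>y\<in>op_space P n. f n (op_add P n x y) = op_add Q n (f n x) (f n y)) \<and>
     (\<forall>n c. \<forall>x\<in>op_space P n. f n (op_scale P n c x) = op_scale Q n c (f n x)) \<and>
     (\<forall>m n i. \<forall>x\<in>op_space P m. \<forall>y\<in>op_space P n. 1 \<le> i \<and> i \<le> m \<longrightarrow>
        f (m + n - 1) (op_comp P m n i x y) = op_comp Q m n i (f m x) (f n y)) \<and>
     f 1 (op_id P) = op_id Q}"

definition operad_kernel :: "('k, 'a) operad \<Rightarrow> ('k, 'b) operad \<Rightarrow> (nat \<Rightarrow> 'a \<Rightarrow> 'b) \<Rightarrow> nat \<Rightarrow> 'a set" where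
  "operad_kernel P Q f n = {x \<in> op_space P n. f n x = op_zero Q n}"

subsection \<open>Ideals and quotients\<close>

definition operad_ideal :: "('k, 'a) operad \<Rightarrow> (nat \<Rightarrow> 'a set) \<Rightarrow> bool" where
  "operad_ideal P I \<longleftrightarrow>
     (\<forall>n. I n \<subseteq> op_space P n \<and> op_zero P n \<in> I n) \<and>
     (\<forall>n. \<forall>x\<in>I n. \<forall>y\<in>I n. op_add P n x y \<in> I n) \<and>
     (\<forall>n c. \<forall>x\<in>I n. op_scale P n c x \<in> I n) \<and>
     (\<forall>m n i. 1 \<le> i \<and> i \<le> m \<longrightarrow>
        (\<forall>x\<in>I m. \<forall>y\<in>op_space P n. op_comp P m n i x y \<in> I (m + n - 1)) \<and>
        (\<forall>x\<in>op_space P m. \<forall>y\<in>I n. op_comp P m n i x y \<in> I (m + n - 1)))"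

definition generated_ideal :: "('k, 'a) operad \<Rightarrow> (nat \<Rightarrow> 'a set) \<Rightarrow> nat \<Rightarrow> 'a set" where
  "generated_ideal P S n = \<Inter> {I n | I. operad_ideal P I \<and> (\<forall>m. S m \<subseteq> I m)}"

definition operad_coset :: "('k, 'a) operad \<Rightarrow> (nat \<Rightarrow> 'a set) \<Rightarrow> nat \<Rightarrow> 'a \<Rightarrow> 'a set" where
  "operad_coset P I n x = op_add P n x ` I n"

definition operad_quotient :: "('k, 'a) operad \<Rightarrow> (nat \<Rightarrow> 'a set) \<Rightarrow> ('k, 'a set) operad" where
  "operad_quotient P I = \<lparr>
     op_space = (\<lambda>n. operad_coset P I n ` op_space P n),
     op_zero = (\<lambda>n. operad_coset P I n (op_zero P n)),
     op_add = (\<lambda>n A B. \<Union>x\<in>A. \<Union>y\<in>B. operad_coset P I n (op_add P n x y)),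
     op_scale = (\<lambda>n c A. \<Union>x\<in>A. operad_coset P I n (op_scale P n c x)),
     op_comp = (\<lambda>m n i A B. \<Union>x\<in>A. \<Union>y\<in>B. operad_coset P I (m + n - 1) (op_comp P m n i x y)),
     op_id = operad_coset P I 1 (op_id P)\<rparr>"

text \<open>The quotient by the ideal generated by a set of relations that all have the same arity.\<close>

definition operad_mod :: "('k, 'a) operad \<Rightarrow> nat \<Rightarrow> 'a set \<Rightarrow> ('k, 'a set) operad" where
  "operad_mod P n R = operad_quotient P (generated_ideal P (\<lambda>m. if m = n then R else {}))"

lemma operad_idealD:
  assumes "operad_ideal P I"
  shows "x \<in> I n \<Longrightarrow> x \<in> op_space P n"
    and "op_zero P n \<in> I n"
    and "x \<in> I n \<Longrightarrow> y \<in> I n \<Longrightarrow> op_add P n x y \<in> I n"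
    and "x \<in> I n \<Longrightarrow> op_scale P n c x \<in> I n"
    and "\<lbrakk>1 \<le> i; i \<le> m; x \<in> I m; y \<in> op_space P n\<rbrakk> \<Longrightarrow> op_comp P m n i x y \<in> I (m + n - 1)"
    and "\<lbrakk>1 \<le> i; i \<le> m; x \<in> op_space P m; y \<in> I n\<rbrakk> \<Longrightarrow> op_comp P m n i x y \<in> I (m + n - 1)"
  using assms by (simp_all add: operad_ideal_def subset_iff del: One_nat_def)

lemma generated_ideal_iff:
  "x \<in> generated_ideal P S n \<longleftrightarrow> (\<forall>I. operad_ideal P I \<longrightarrow> (\<forall>m. S m \<subseteq> I m) \<longrightarrow> x \<in> I n)"
  unfolding generated_ideal_def by blast

lemma (in ns_operad) generated_ideal_is_ideal:
  assumes "\<And>n. S n \<subseteq> op_space P n"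
  shows "operad_ideal P (generated_ideal P S)"
proof -
  have "operad_ideal P (op_space P)"
    by (auto simp: operad_ideal_def zero_closed add_closed scale_closed comp_closed[simplified])
  with assms have sub: "generated_ideal P S n \<subseteq> op_space P n" for n
    unfolding generated_ideal_iff subset_iff by blast
  show ?thesis
    unfolding operad_ideal_def[of _ "generated_ideal P S"]
  proof (intro conjI allI ballI impI)
    fix m n i :: nat and c and x y
    show "generated_ideal P S n \<subseteq> op_space P n" by (rule sub)
    show "op_zero P n \<in> generated_ideal P S n"
      unfolding generated_ideal_iff by (blast intro: operad_idealD(2))
    show "op_add P n x y \<in> generated_ideal P S n"
      if "x \<in> generated_ideal P S n" "y \<in> generated_ideal P S n"
      using that unfolding generated_ideal_iff by (blast intro: operad_idealD(3))
    show "op_scale P n c x \<in> generated_ideal P S n" if "x \<in> generated_ideal P S n"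
      using that unfolding generated_ideal_iff by (blast intro: operad_idealD(4))
    assume i: "1 \<le> i \<and> i \<le> m"
    show "op_comp P m n i x y \<in> generated_ideal P S (m + n - 1)"
      if "x \<in> generated_ideal P S m" "y \<in> op_space P n"
      using that i unfolding generated_ideal_iff by (blast intro: operad_idealD(5))
    show "op_comp P m n i x y \<in> generated_ideal P S (m + n - 1)"
      if "x \<in> op_space P m" "y \<in> generated_ideal P S n"
      using that i unfolding generated_ideal_iff by (blast intro: operad_idealD(6))
  qed
qed

lemma (in ns_operad) add_left_commute:
  "\<lbrakk>x \<in> op_space P n; y \<in> op_space P n; z \<in> op_space P n\<rbrakk>
    \<Longrightarrow> op_add P n x (op_add P n y z) = op_add P n y (op_add P n x z)"
  by (metis add_assoc add_commute)

locale operad_with_ideal = ns_operad P for P :: "('k::field, 'a) operad" +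
  fixes I :: "nat \<Rightarrow> 'a set"
  assumes ideal: "operad_ideal P I"
begin

abbreviation cls where "cls \<equiv> operad_coset P I"
abbreviation quo where "quo \<equiv> operad_quotient P I"

lemmas ideal_sub = operad_idealD(1)[OF ideal]
  and ideal_zero = operad_idealD(2)[OF ideal]
  and ideal_add = operad_idealD(3)[OF ideal]
  and ideal_scale = operad_idealD(4)[OF ideal]
  and ideal_comp_left = operad_idealD(5)[OF ideal]
  and ideal_comp_right = operad_idealD(6)[OF ideal]

lemma cls_add_ideal:
  assumes "x \<in> op_space P n" "a \<in> I n"
  shows "cls n (op_add P n x a) = cls n x"
proof (intro subset_antisym subsetI)
  fix z assume "z \<in> cls n (op_add P n x a)"
  then obtain b where "b \<in> I n" "z = op_add P n (op_add P n x a) b"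
    by (auto simp: operad_coset_def)
  then have "z = op_add P n x (op_add P n a b)" "op_add P n a b \<in> I n"
    using assms by (auto simp: add_assoc ideal_sub ideal_add)
  then show "z \<in> cls n x" by (auto simp: operad_coset_def)
next
  fix z assume "z \<in> cls n x"
  then obtain b where b: "b \<in> I n" "z = op_add P n x b"
    by (auto simp: operad_coset_def)
  let ?c = "op_add P n (op_scale P n (-1) a) b"
  have c: "?c \<in> I n" using assms b by (simp add: ideal_scale ideal_add)
  have "op_add P n a ?c = op_add P n (op_add P n a (op_scale P n (-1) a)) b"
    using assms b by (simp add: add_assoc ideal_sub scale_closed)
  also have "\<dots> = b"
    using assms b by (simp add: add_minus add_commute[OF zero_closed] add_zero ideal_sub)
  finally have "z = op_add P n (op_add P n x a) ?c"
    using assms b c by (simp add: add_assoc ideal_sub)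
  with c show "z \<in> cls n (op_add P n x a)" by (auto simp: operad_coset_def)
qed

lemma cls_memE:
  assumes "z \<in> cls n x"
  obtains a where "a \<in> I n" "z = op_add P n x a"
  using assms by (auto simp: operad_coset_def)

lemma cls_self: "x \<in> op_space P n \<Longrightarrow> x \<in> cls n x"
  unfolding operad_coset_def by (rule image_eqI[of _ _ "op_zero P n"]) (simp_all add: add_zero ideal_zero)

lemma UN_const_eq: "\<lbrakk>a \<in> A; \<And>x. x \<in> A \<Longrightarrow> f x = C\<rbrakk> \<Longrightarrow> (\<Union>x\<in>A. f x) = C"
  by (rule subset_antisym[OF UN_least]) (simp_all, fast)

lemma quo_add:
  assumes "x \<in> op_space P n" "y \<in> op_space P n"
  shows "op_add quo n (cls n x) (cls n y) = cls n (op_add P n x y)"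
proof -
  have "cls n (op_add P n x' y') = cls n (op_add P n x y)" if "x' \<in> cls n x" "y' \<in> cls n y" for x' y'
  proof -
    from that obtain a b where ab: "a \<in> I n" "b \<in> I n" "x' = op_add P n x a" "y' = op_add P n y b"
      by (elim cls_memE)
    have "op_add P n a (op_add P n y b) = op_add P n y (op_add P n a b)"
      using ab assms by (simp only: add_left_commute ideal_sub)
    then have "op_add P n x' y' = op_add P n (op_add P n x y) (op_add P n a b)"
      using ab assms by (simp add: add_assoc ideal_sub add_closed)
    with ab assms show ?thesis by (simp add: cls_add_ideal add_closed ideal_add)
  qed
  then show ?thesis
    unfolding operad_quotient_def operad.simps
    by (intro UN_const_eq[OF cls_self[OF assms(1)]] UN_const_eq[OF cls_self[OF assms(2)]])
qed

lemma quo_scale: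
  assumes "x \<in> op_space P n"
  shows "op_scale quo n c (cls n x) = cls n (op_scale P n c x)"
proof -
  have "cls n (op_scale P n c x') = cls n (op_scale P n c x)" if "x' \<in> cls n x" for x'
  proof -
    from that obtain a where "a \<in> I n" "x' = op_add P n x a" by (elim cls_memE)
    with assms show ?thesis by (simp add: scale_add ideal_sub cls_add_ideal scale_closed ideal_scale)
  qed
  then show ?thesis
    unfolding operad_quotient_def operad.simps by (intro UN_const_eq[OF cls_self[OF assms]])
qed

lemma quo_comp:
  assumes "x \<in> op_space P m" "y \<in> op_space P n" "1 \<le> i" "i \<le> m"
  shows "op_comp quo m n i (cls m x) (cls n y) = cls (m + n - 1) (op_comp P m n i x y)"
proof -
  have "cls (m + n - 1) (op_comp P m n i x' y') = cls (m + n - 1) (op_comp P m n i x y)"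
    if "x' \<in> cls m x" "y' \<in> cls n y" for x' y'
  proof -
    from that obtain a b where ab: "a \<in> I m" "b \<in> I n" "x' = op_add P m x a" "y' = op_add P n y b"
      by (elim cls_memE)
    have "op_comp P m n i x' y' = op_add P (m + n - 1) (op_comp P m n i x y') (op_comp P m n i a y')"
      using ab assms by (simp only: comp_add_left ideal_sub add_closed)
    also have "cls (m + n - 1) \<dots> = cls (m + n - 1) (op_comp P m n i x y')"
      using ab assms by (intro cls_add_ideal comp_closed ideal_comp_left) (simp_all add: ideal_sub add_closed)
    also have "op_comp P m n i x y' = op_add P (m + n - 1) (op_comp P m n i x y) (op_comp P m n i x b)"
      using ab assms by (simp only: comp_add_right ideal_sub)
    also have "cls (m + n - 1) \<dots> = cls (m + n - 1) (op_comp P m n i x y)"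
      using ab assms by (intro cls_add_ideal comp_closed ideal_comp_right)
    finally show ?thesis .
  qed
  then show ?thesis
    unfolding operad_quotient_def operad.simps
    by (intro UN_const_eq[OF cls_self[OF assms(1)]] UN_const_eq[OF cls_self[OF assms(2)]])
qed

lemma quo_space: "op_space quo n = cls n ` op_space P n"
  and quo_zero: "op_zero quo n = cls n (op_zero P n)"
  and quo_id: "op_id quo = cls 1 (op_id P)"
  by (simp_all add: operad_quotient_def)

lemma quo_comp':
  assumes "x \<in> op_space P m" "y \<in> op_space P n" "1 \<le> i" "i \<le> m" "k = m + n - 1"
  shows "op_comp quo m n i (cls m x) (cls n y) = cls k (op_comp P m n i x y)"
  using quo_comp assms by simp

lemma comp_closed':
  "\<lbrakk>x \<in> op_space P m; y \<in> op_space P n; 1 \<le> i; i \<le> m; k = m + n - 1\<rbrakk> \<Longrightarrow> op_comp P m n i x y \<in> op_space P k"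
  using comp_closed by simp

theorem ns_operad_quotient: "ns_operad quo"
proof
  fix l m n i j k :: nat and x y z
  show "op_comp quo (l + m - 1) n (i - 1 + j) (op_comp quo l m i x y) z
      = op_comp quo l (m + n - 1) i x (op_comp quo m n j y z)"
    if "x \<in> op_space quo l" "y \<in> op_space quo m" "z \<in> op_space quo n" "1 \<le> i" "i \<le> l" "1 \<le> j" "j \<le> m"
  proof -
    from that obtain x' y' z' where xyz: "x' \<in> op_space P l" "y' \<in> op_space P m" "z' \<in> op_space P n"
      "x = cls l x'" "y = cls m y'" "z = cls n z'" by (auto simp: quo_space)
    have i: "1 \<le> i - 1 + j" "i - 1 + j \<le> l + m - 1" "l + m - 1 + n - 1 = l + (m + n - 1) - 1"
      using that by linarith+
    have "op_comp quo (l + m - 1) n (i - 1 + j) (op_comp quo l m i x y) z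
        = cls (l + m - 1 + n - 1) (op_comp P (l + m - 1) n (i - 1 + j) (op_comp P l m i x' y') z')"
      unfolding xyz using xyz i that by (simp only: quo_comp comp_closed)
    moreover have "op_comp quo l (m + n - 1) i x (op_comp quo m n j y z)
        = cls (l + (m + n - 1) - 1) (op_comp P l (m + n - 1) i x' (op_comp P m n j y' z'))"
      unfolding xyz using xyz i that by (simp only: quo_comp comp_closed)
    ultimately show ?thesis
      using comp_sequential[OF xyz(1-3) that(4-7)] i(3) by (simp only:)
  qed
  show "op_comp quo (l + m - 1) n (k - 1 + m) (op_comp quo l m i x y) z
      = op_comp quo (l + n - 1) m i (op_comp quo l n k x z) y"
    if "x \<in> op_space quo l" "y \<in> op_space quo m" "z \<in> op_space quo n" "1 \<le> i" "i < k" "k \<le> l"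
  proof -
    from that obtain x' y' z' where xyz: "x' \<in> op_space P l" "y' \<in> op_space P m" "z' \<in> op_space P n"
      "x = cls l x'" "y = cls m y'" "z = cls n z'" by (auto simp: quo_space)
    have i: "1 \<le> k - 1 + m" "k - 1 + m \<le> l + m - 1" "l + m - 1 + n - 1 = l + n - 1 + m - 1"
      "i \<le> l" "1 \<le> k" "i \<le> l + n - 1"
      using that by linarith+
    have "op_comp quo (l + m - 1) n (k - 1 + m) (op_comp quo l m i x y) z
        = cls (l + m - 1 + n - 1) (op_comp P (l + m - 1) n (k - 1 + m) (op_comp P l m i x' y') z')"
      unfolding xyz using xyz i that by (simp only: quo_comp comp_closed)
    moreover have "op_comp quo (l + n - 1) m i (op_comp quo l n k x z) y
        = cls (l + n - 1 + m - 1) (op_comp P (l + n - 1) m i (op_comp P l n k x' z') y')"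
      unfolding xyz using xyz i that by (simp only: quo_comp comp_closed)
    ultimately show ?thesis
      using comp_parallel[OF xyz(1-3) that(4-6)] i(3) by (simp only:)
  qed
  show "op_add quo n x y = op_add quo n y x" if "x \<in> op_space quo n" "y \<in> op_space quo n"
    using that by (auto simp: quo_space quo_add add_commute)
  show "op_comp quo 1 n 1 (op_id quo) x = x" if "x \<in> op_space quo n"
    using that by (auto simp: quo_space quo_id quo_comp'[of _ 1 _ n _ n] id_closed comp_id_left simp del: One_nat_def)
  show "op_comp quo n 1 i x (op_id quo) = x" if "x \<in> op_space quo n" "1 \<le> i" "i \<le> n"
    using that by (auto simp: quo_space quo_id quo_comp'[of _ n _ 1 _ n] id_closed comp_id_right simp del: One_nat_def)
qed (auto simp: quo_space quo_zero quo_id quo_add quo_scale quo_comp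
    zero_closed add_closed scale_closed comp_closed id_closed
    add_assoc add_zero add_minus scale_add add_scale scale_scale scale_one
    comp_add_left comp_add_right comp_scale_left comp_scale_right simp del: One_nat_def)

end

section \<open>Finite formal linear combinations\<close>

text \<open>The vector space with basis the type \<open>'b\<close> is the type \<open>'b \<Rightarrow>\<^sub>0 'k\<close>.\<close>

definition lc_scale :: "'k::field \<Rightarrow> ('b \<Rightarrow>\<^sub>0 'k) \<Rightarrow> ('b \<Rightarrow>\<^sub>0 'k)" (infixr "\<cdot>\<^sub>k" 75) where
  "c \<cdot>\<^sub>k x = Poly_Mapping.map ((*) c) x"

definition lc_basis :: "'b \<Rightarrow> ('b \<Rightarrow>\<^sub>0 'k::field)" where
  "lc_basis b = Poly_Mapping.single b 1"

definition linear_ext :: "('b \<Rightarrow> ('c \<Rightarrow>\<^sub>0 'k)) \<Rightarrow> ('b \<Rightarrow>\<^sub>0 'k::field) \<Rightarrow> ('c \<Rightarrow>\<^sub>0 'k)" where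
  "linear_ext f x = (\<Sum>b\<in>Poly_Mapping.keys x. Poly_Mapping.lookup x b \<cdot>\<^sub>k f b)"

definition bilinear_ext ::
  "('b \<Rightarrow> 'c \<Rightarrow> 'd) \<Rightarrow> ('b \<Rightarrow>\<^sub>0 'k::field) \<Rightarrow> ('c \<Rightarrow>\<^sub>0 'k) \<Rightarrow> ('d \<Rightarrow>\<^sub>0 'k)" where
  "bilinear_ext f x y = linear_ext (\<lambda>b. linear_ext (\<lambda>c. lc_basis (f b c)) y) x"

lemma lookup_lc_scale [simp]:
  "Poly_Mapping.lookup (c \<cdot>\<^sub>k x) b = c * Poly_Mapping.lookup x b"
  unfolding lc_scale_def by transfer (simp add: when_def)

lemma lc_vector_space: "vector_space (lc_scale :: 'k::field \<Rightarrow> ('b \<Rightarrow>\<^sub>0 'k) \<Rightarrow> _)"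
  by unfold_locales (rule poly_mapping_eqI, simp add: lookup_add algebra_simps)+

interpretation lc: vector_space "lc_scale :: 'k::field \<Rightarrow> ('b \<Rightarrow>\<^sub>0 'k) \<Rightarrow> _"
  by (rule lc_vector_space)

lemma keys_lc_scale: "Poly_Mapping.keys (c \<cdot>\<^sub>k x) \<subseteq> Poly_Mapping.keys x"
  by (auto simp: in_keys_iff)

lemma linear_ext_superset:
  assumes "finite A" "Poly_Mapping.keys x \<subseteq> A"
  shows "linear_ext f x = (\<Sum>b\<in>A. Poly_Mapping.lookup x b \<cdot>\<^sub>k f b)"
  unfolding linear_ext_def
  by (rule sum.mono_neutral_left) (use assms in \<open>auto simp: in_keys_iff\<close>)

lemma linear_ext_add: "linear_ext f (x + y) = linear_ext f x + linear_ext f y"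
proof -
  let ?A = "Poly_Mapping.keys x \<union> Poly_Mapping.keys y"
  have "finite ?A" by simp
  then show ?thesis
    by (simp add: linear_ext_superset[of ?A] keys_add lookup_add lc.scale_left_distrib sum.distrib)
qed

lemma linear_ext_scale: "linear_ext f (c \<cdot>\<^sub>k x) = c \<cdot>\<^sub>k linear_ext f x"
  by (simp add: linear_ext_superset[of "Poly_Mapping.keys x"] keys_lc_scale lc.scale_sum_right)

lemma linear_ext_zero [simp]: "linear_ext f 0 = 0"
  by (simp add: linear_ext_def)

lemma linear_ext_basis [simp]: "linear_ext f (lc_basis b) = f b"
  by (simp add: linear_ext_def lc_basis_def)

lemma linear_ext_add_fun: "linear_ext (\<lambda>b. f b + g b) x = linear_ext f x + linear_ext g x"
  by (simp add: linear_ext_def lc.scale_right_distrib sum.distrib)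

lemma linear_ext_scale_fun: "linear_ext (\<lambda>b. c \<cdot>\<^sub>k f b) x = c \<cdot>\<^sub>k linear_ext f x"
  by (simp add: linear_ext_def lc.scale_sum_right mult.commute)

lemma linear_ext_zero_fun [simp]: "linear_ext (\<lambda>b. 0) x = 0"
  by (simp add: linear_ext_def)

lemma linear_ext_cong:
  "(\<And>b. b \<in> Poly_Mapping.keys x \<Longrightarrow> f b = g b) \<Longrightarrow> linear_ext f x = linear_ext g x"
  by (simp add: linear_ext_def)

lemma linear_ext_lc_basis: "linear_ext lc_basis x = x"
  by (rule poly_mapping_eqI)
    (simp add: linear_ext_def lookup_sum lc_basis_def lookup_single when_def if_distrib
      in_keys_iff cong: if_cong)

lemma linear_ext_sum: "finite A \<Longrightarrow> linear_ext f (sum h A) = (\<Sum>b\<in>A. linear_ext f (h b))"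
  by (induction A rule: finite_induct) (simp_all add: linear_ext_add)

lemma linear_ext_comp: "linear_ext f (linear_ext g x) = linear_ext (\<lambda>b. linear_ext f (g b)) x"
  by (simp add: linear_ext_def[of g] linear_ext_def[of "\<lambda>b. linear_ext f (g b)"]
      linear_ext_scale linear_ext_sum)

lemma linear_ext_swap:
  "linear_ext (\<lambda>b. linear_ext (\<lambda>c. f b c) y) x = linear_ext (\<lambda>c. linear_ext (\<lambda>b. f b c) x) y"
  by (simp add: linear_ext_def lc.scale_sum_right sum.swap[of _ _ "Poly_Mapping.keys x"] mult.commute)

lemma keys_linear_ext:
  "Poly_Mapping.keys (linear_ext f x) \<subseteq> (\<Union>b\<in>Poly_Mapping.keys x. Poly_Mapping.keys (f b))"
proof
  fix c assume "c \<in> Poly_Mapping.keys (linear_ext f x)"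
  then have "(\<Sum>b\<in>Poly_Mapping.keys x. Poly_Mapping.lookup x b * Poly_Mapping.lookup (f b) c) \<noteq> 0"
    by (simp add: in_keys_iff linear_ext_def lookup_sum)
  then obtain b where "b \<in> Poly_Mapping.keys x" "Poly_Mapping.lookup x b * Poly_Mapping.lookup (f b) c \<noteq> 0"
    by (meson sum.neutral)
  then show "c \<in> (\<Union>b\<in>Poly_Mapping.keys x. Poly_Mapping.keys (f b))"
    by (auto simp: in_keys_iff)
qed

lemma keys_bilinear_ext:
  "Poly_Mapping.keys (bilinear_ext f x y) \<subseteq> (\<Union>b\<in>Poly_Mapping.keys x. f b ` Poly_Mapping.keys y)"
  unfolding bilinear_ext_def
  by (rule order_trans[OF keys_linear_ext])
    (auto simp: lc_basis_def dest!: subsetD[OF keys_linear_ext])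

section \<open>The free nonsymmetric operad\<close>

text \<open>
  For a graded vector space \<open>W\<close> with homogeneous basis \<open>'g\<close>, graded by \<open>ar :: 'g \<Rightarrow> nat\<close>, the space of
  the free operad in arity \<open>n\<close> has as basis the planar rooted trees with \<open>n\<close> leaves whose internal
  vertices are decorated by generators, with as many children as the arity of the decoration.
  The leaves of a tree are numbered from left to right, starting with 1.
\<close>

datatype 'g tree = Leaf | Node 'g "'g tree list"

fun leaves :: "'g tree \<Rightarrow> nat" where
  "leaves Leaf = 1"
| "leaves (Node g ts) = sum_list (map leaves ts)"

fun wf_tree :: "('g \<Rightarrow> nat) \<Rightarrow> 'g tree \<Rightarrow> bool" where
  "wf_tree ar Leaf \<longleftrightarrow> True"
| "wf_tree ar (Node g ts) \<longleftrightarrow> length ts = ar g \<and> (\<forall>t\<in>set ts. wf_tree ar t)"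

text \<open>\<open>graft t i s\<close> replaces the \<open>i\<close>-th leaf of \<open>t\<close> by \<open>s\<close>.\<close>

fun graft :: "'g tree \<Rightarrow> nat \<Rightarrow> 'g tree \<Rightarrow> 'g tree"
  and graft_list :: "'g tree list \<Rightarrow> nat \<Rightarrow> 'g tree \<Rightarrow> 'g tree list" where
  "graft Leaf i s = s"
| "graft (Node g ts) i s = Node g (graft_list ts i s)"
| "graft_list [] i s = []"
| "graft_list (t # ts) i s =
     (if i \<le> leaves t then graft t i s # ts else t # graft_list ts (i - leaves t) s)"

definition tree_comp ::
  "('g tree \<Rightarrow>\<^sub>0 'k::field) \<Rightarrow> nat \<Rightarrow> ('g tree \<Rightarrow>\<^sub>0 'k) \<Rightarrow> ('g tree \<Rightarrow>\<^sub>0 'k)"  ("_ \<circ>\<^bsub>_\<^esub> _" [76, 0, 77] 76) where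
  "x \<circ>\<^bsub>i\<^esub> y = bilinear_ext (\<lambda>t s. graft t i s) x y"

definition free_operad :: "('g \<Rightarrow> nat) \<Rightarrow> ('k::field, 'g tree \<Rightarrow>\<^sub>0 'k) operad" where
  "free_operad ar = \<lparr>
     op_space = (\<lambda>n. {x. \<forall>t\<in>Poly_Mapping.keys x. wf_tree ar t \<and> leaves t = n}),
     op_zero = (\<lambda>_. 0),
     op_add = (\<lambda>_. (+)),
     op_scale = (\<lambda>_. (\<cdot>\<^sub>k)),
     op_comp = (\<lambda>_ _ i x y. x \<circ>\<^bsub>i\<^esub> y),
     op_id = lc_basis Leaf\<rparr>"

lemma leaves_graft:
  "1 \<le> i \<Longrightarrow> i \<le> leaves t \<Longrightarrow> leaves (graft t i s) = leaves t + leaves s - 1"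
  "1 \<le> i \<Longrightarrow> i \<le> sum_list (map leaves ts)
    \<Longrightarrow> sum_list (map leaves (graft_list ts i s)) = sum_list (map leaves ts) + leaves s - 1"
  by (induction t i s and ts i s rule: graft_graft_list.induct) auto

lemma length_graft_list [simp]: "length (graft_list ts i s) = length ts"
  by (induction ts arbitrary: i) auto

lemma wf_tree_graft:
  "wf_tree ar t \<Longrightarrow> wf_tree ar s \<Longrightarrow> wf_tree ar (graft t i s)"
  "\<forall>t\<in>set ts. wf_tree ar t \<Longrightarrow> wf_tree ar s \<Longrightarrow> \<forall>t\<in>set (graft_list ts i s). wf_tree ar t"
  by (induction t i s and ts i s rule: graft_graft_list.induct) auto

lemma graft_Leaf:
  fixes t :: "'a tree" and ts :: "'a tree list"
  shows "graft t i Leaf = t" "graft_list ts i Leaf = ts"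
  by (induction t i "Leaf :: 'a tree" and ts i "Leaf :: 'a tree" rule: graft_graft_list.induct) auto

lemma graft_sequential:
  "\<lbrakk>1 \<le> i; i \<le> leaves t; 1 \<le> j; j \<le> leaves s\<rbrakk>
    \<Longrightarrow> graft (graft t i s) (i - 1 + j) u = graft t i (graft s j u)"
  "\<lbrakk>1 \<le> i; i \<le> sum_list (map leaves ts); 1 \<le> j; j \<le> leaves s\<rbrakk>
    \<Longrightarrow> graft_list (graft_list ts i s) (i - 1 + j) u = graft_list ts i (graft s j u)"
proof (induction t i s and ts i s rule: graft_graft_list.induct)
  case (4 t ts i s)
  show ?case
  proof (cases "i \<le> leaves t")
    case True
    then have "i - 1 + j \<le> leaves t + leaves s - 1" using 4 by linarith
    with 4 True show ?thesis by (simp add: leaves_graft)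
  next
    case False
    then have "i - 1 + j - leaves t = i - leaves t - 1 + j" by simp
    moreover have "\<not> i - 1 + j \<le> leaves t" using 4 False by linarith
    ultimately show ?thesis using 4 False by simp
  qed
qed auto

lemma graft_parallel:
  "\<lbrakk>1 \<le> i; i < k; k \<le> leaves t\<rbrakk>
    \<Longrightarrow> graft (graft t i s) (k - 1 + leaves s) u = graft (graft t k u) i s"
  "\<lbrakk>1 \<le> i; i < k; k \<le> sum_list (map leaves ts)\<rbrakk>
    \<Longrightarrow> graft_list (graft_list ts i s) (k - 1 + leaves s) u = graft_list (graft_list ts k u) i s"
proof (induction t i s and ts i s arbitrary: k and k rule: graft_graft_list.induct)
  case (4 t ts i s)
  consider "k \<le> leaves t" | "i \<le> leaves t" "leaves t < k" | "leaves t < i" by linarith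
  then show ?case
  proof cases
    case 1
    have "k - 1 + leaves s \<le> leaves t + leaves s - 1" "i \<le> leaves t + leaves u - 1"
      using 1 4 by linarith+
    with 1 4 show ?thesis by (simp add: leaves_graft)
  next
    case 2
    have eq: "k - 1 + leaves s - (leaves t + leaves s - 1) = k - leaves t"
      using 2 4 by simp
    have "\<not> k - 1 + leaves s \<le> leaves t + leaves s - 1"
      using 2 4 by linarith
    then show ?thesis using 2 4 eq by (simp add: leaves_graft)
  next
    case 3
    then have eq: "k - 1 + leaves s - leaves t = k - leaves t - 1 + leaves s"
      using 4 by simp
    have "\<not> k - 1 + leaves s \<le> leaves t" using 3 4 by linarith
    moreover have "graft_list (graft_list ts (i - leaves t) s) (k - leaves t - 1 + leaves s) u
        = graft_list (graft_list ts (k - leaves t) u) (i - leaves t) s"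
      using 3 4(3-5) by (intro 4(2)) auto
    ultimately show ?thesis using 3 4(3-5) eq by simp
  qed
qed auto

lemma lc_basis_comp: "lc_basis t \<circ>\<^bsub>i\<^esub> lc_basis s = lc_basis (graft t i s)"
  by (simp add: tree_comp_def bilinear_ext_def)

lemma tree_comp_assoc_aux:
  "(x \<circ>\<^bsub>i\<^esub> y) \<circ>\<^bsub>j\<^esub> z =
    linear_ext (\<lambda>t. linear_ext (\<lambda>s. linear_ext (\<lambda>u. lc_basis (graft (graft t i s) j u)) z) y) x"
  "x \<circ>\<^bsub>i\<^esub> (y \<circ>\<^bsub>j\<^esub> z) =
    linear_ext (\<lambda>t. linear_ext (\<lambda>s. linear_ext (\<lambda>u. lc_basis (graft t i (graft s j u))) z) y) x"
  by (simp_all add: tree_comp_def bilinear_ext_def linear_ext_comp)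

lemma ns_operad_free: "ns_operad (free_operad ar :: ('k::field, 'g tree \<Rightarrow>\<^sub>0 'k) operad)"
proof
  fix l m n i j k :: nat and x y z :: "'g tree \<Rightarrow>\<^sub>0 'k"
  let ?F = "free_operad ar :: ('k, 'g tree \<Rightarrow>\<^sub>0 'k) operad"
  show "op_comp ?F m n i x y \<in> op_space ?F (m + n - 1)"
    if "x \<in> op_space ?F m" "y \<in> op_space ?F n" "1 \<le> i" "i \<le> m"
  proof -
    have "wf_tree ar u \<and> leaves u = m + n - 1" if "u \<in> Poly_Mapping.keys (x \<circ>\<^bsub>i\<^esub> y)" for u
    proof -
      from that obtain t s where "t \<in> Poly_Mapping.keys x" "s \<in> Poly_Mapping.keys y" "u = graft t i s"
        using keys_bilinear_ext unfolding tree_comp_def by fast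
      with \<open>x \<in> _\<close> \<open>y \<in> _\<close> \<open>1 \<le> i\<close> \<open>i \<le> m\<close> show ?thesis
        by (auto simp: free_operad_def leaves_graft wf_tree_graft)
    qed
    then show ?thesis by (simp add: free_operad_def)
  qed
  show "op_comp ?F (l + m - 1) n (i - 1 + j) (op_comp ?F l m i x y) z
      = op_comp ?F l (m + n - 1) i x (op_comp ?F m n j y z)"
    if "x \<in> op_space ?F l" "y \<in> op_space ?F m" "z \<in> op_space ?F n" "1 \<le> i" "i \<le> l" "1 \<le> j" "j \<le> m"
    using that unfolding free_operad_def
    by (auto simp: tree_comp_assoc_aux graft_sequential(1)[symmetric] intro!: linear_ext_cong)
  show "op_comp ?F (l + m - 1) n (k - 1 + m) (op_comp ?F l m i x y) z
      = op_comp ?F (l + n - 1) m i (op_comp ?F l n k x z) y"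
    if "x \<in> op_space ?F l" "y \<in> op_space ?F m" "z \<in> op_space ?F n" "1 \<le> i" "i < k" "k \<le> l"
  proof -
    have "(x \<circ>\<^bsub>i\<^esub> y) \<circ>\<^bsub>k - 1 + m\<^esub> z =
      linear_ext (\<lambda>t. linear_ext (\<lambda>s. linear_ext (\<lambda>u. lc_basis (graft (graft t k u) i s)) z) y) x"
      unfolding tree_comp_assoc_aux using that
      by (intro linear_ext_cong) (auto simp: free_operad_def graft_parallel(1)[symmetric])
    also have "\<dots> = (x \<circ>\<^bsub>k\<^esub> z) \<circ>\<^bsub>i\<^esub> y"
      unfolding tree_comp_assoc_aux by (subst linear_ext_swap[of _ z y]) simp
    finally show ?thesis by (simp add: free_operad_def)
  qed
  show "op_comp ?F 1 n 1 (op_id ?F) x = x"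
    by (simp add: free_operad_def tree_comp_def bilinear_ext_def linear_ext_lc_basis)
  show "op_comp ?F n 1 i x (op_id ?F) = x"
    by (simp add: free_operad_def tree_comp_def bilinear_ext_def linear_ext_lc_basis graft_Leaf)
  show "op_id ?F \<in> op_space ?F 1"
    by (simp add: free_operad_def lc_basis_def)
  show "op_add ?F n x y \<in> op_space ?F n" if "x \<in> op_space ?F n" "y \<in> op_space ?F n"
    using that keys_add[of x y] by (auto simp: free_operad_def)
  show "op_scale ?F n c x \<in> op_space ?F n" if "x \<in> op_space ?F n" for c
    using that keys_lc_scale[of c x] by (auto simp: free_operad_def)
qed (simp_all add: free_operad_def tree_comp_def bilinear_ext_def linear_ext_add linear_ext_scale
    linear_ext_add_fun linear_ext_scale_fun lc.scale_right_distrib lc.scale_left_distrib add.assoc add.commute)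

definition op_gen :: "('g \<Rightarrow> nat) \<Rightarrow> 'g \<Rightarrow> ('g tree \<Rightarrow>\<^sub>0 'k::field)" where
  "op_gen ar g = lc_basis (Node g (replicate (ar g) Leaf))"

section \<open>Binary quadratic operads presented by pairs of tensors\<close>

text \<open>
  \<open>V = ('v \<Rightarrow>\<^sub>0 'k)\<close> is placed in arity 2 and \<open>V \<otimes> V\<close> is the vector space with basis \<open>'v \<times> 'v\<close>.
\<close>

type_synonym ('v, 'k) tensor_pair = "(('v \<times> 'v) \<Rightarrow>\<^sub>0 'k) \<times> (('v \<times> 'v) \<Rightarrow>\<^sub>0 'k)"

abbreviation free_binary :: "('k::field, 'v tree \<Rightarrow>\<^sub>0 'k) operad" where
  "free_binary \<equiv> free_operad (\<lambda>_. 2)"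

abbreviation bin_gen :: "'v \<Rightarrow> ('v tree \<Rightarrow>\<^sub>0 'k::field)" where
  "bin_gen \<equiv> op_gen (\<lambda>_. 2)"

definition tensor :: "('v \<Rightarrow>\<^sub>0 'k::field) \<Rightarrow> ('v \<Rightarrow>\<^sub>0 'k) \<Rightarrow> ('v \<times> 'v \<Rightarrow>\<^sub>0 'k)" (infixr "\<otimes>\<^sub>k" 70) where
  "u \<otimes>\<^sub>k v = bilinear_ext Pair u v"

definition pair_scale :: "'k::field \<Rightarrow> ('v, 'k) tensor_pair \<Rightarrow> ('v, 'k) tensor_pair" where
  "pair_scale c p = (c \<cdot>\<^sub>k fst p, c \<cdot>\<^sub>k snd p)"

text \<open>
  The identification of \<open>V \<otimes> V \<oplus> V \<otimes> V\<close> with the space of arity 3 of the free operad: the pair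
  \<open>(a \<otimes> b, c \<otimes> d)\<close> encodes the relation \<open>(x a y) b z = x c (y d z)\<close>.
\<close>

definition quadratic_relation :: "('v, 'k::field) tensor_pair \<Rightarrow> ('v tree \<Rightarrow>\<^sub>0 'k)" where
  "quadratic_relation p =
     linear_ext (\<lambda>(a, b). bin_gen b \<circ>\<^bsub>1\<^esub> bin_gen a) (fst p)
     - linear_ext (\<lambda>(c, d). bin_gen c \<circ>\<^bsub>2\<^esub> bin_gen d) (snd p)"

lemma pair_vector_space: "vector_space (pair_scale :: 'k::field \<Rightarrow> ('v, 'k) tensor_pair \<Rightarrow> _)"
  by unfold_locales
    (simp_all add: pair_scale_def plus_prod_def lc.scale_right_distrib lc.scale_left_distrib)

lemma bin_gen_comp:
  "bin_gen b \<circ>\<^bsub>1\<^esub> bin_gen a = lc_basis (Node b [Node a [Leaf, Leaf], Leaf])"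
  "bin_gen c \<circ>\<^bsub>2\<^esub> bin_gen d = lc_basis (Node c [Leaf, Node d [Leaf, Leaf]])"
  by (simp_all add: op_gen_def lc_basis_comp eval_nat_numeral)

lemma lookup_linear_ext_inj:
  assumes "inj f"
  shows "Poly_Mapping.lookup (linear_ext (\<lambda>b. lc_basis (f b)) x) (f a) = Poly_Mapping.lookup x a"
  using inj_eq[OF assms]
  by (simp add: linear_ext_def lookup_sum lc_basis_def lookup_single when_def if_distrib
      in_keys_iff cong: if_cong)

lemma lookup_linear_ext_notin:
  assumes "\<And>b. t \<noteq> f b"
  shows "Poly_Mapping.lookup (linear_ext (\<lambda>b. lc_basis (f b)) x) t = 0"
  using not_sym[OF assms]
  by (simp add: linear_ext_def lookup_sum lc_basis_def lookup_single when_def)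

lemma wf_binary_Node:
  assumes "wf_tree (\<lambda>_. 2) (Node g ts)"
  obtains s u where "ts = [s, u]" "wf_tree (\<lambda>_. 2) s" "wf_tree (\<lambda>_. 2) u"
proof -
  from assms have "length ts = Suc (Suc 0)" by simp
  then obtain s u where "ts = [s, u]" by (auto simp: length_Suc_conv)
  with assms that show ?thesis by simp
qed

lemma leaves_binary_pos: "wf_tree (\<lambda>_. 2) t \<Longrightarrow> 1 \<le> leaves t"
proof (induction t)
  case (Node g ts)
  from Node.prems obtain s u where "ts = [s, u]" "wf_tree (\<lambda>_. 2) s" "wf_tree (\<lambda>_. 2) u"
    by (rule wf_binary_Node)
  with Node.IH[of s] show ?case by simp
qed simp

lemma binary_NodeE:
  assumes "wf_tree (\<lambda>_. 2) t" "t \<noteq> Leaf"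
  obtains g s u where "t = Node g [s, u]" "wf_tree (\<lambda>_. 2) s" "wf_tree (\<lambda>_. 2) u"
    "leaves t = leaves s + leaves u" "1 \<le> leaves s" "1 \<le> leaves u"
proof -
  from assms obtain g ts where t: "t = Node g ts" by (cases t) auto
  with assms(1) have "wf_tree (\<lambda>_. 2) (Node g ts)" by (simp only:)
  then obtain s u where "ts = [s, u]" "wf_tree (\<lambda>_. 2) s" "wf_tree (\<lambda>_. 2) u"
    by (rule wf_binary_Node)
  then show ?thesis by (intro that[of g s u] leaves_binary_pos) (simp_all add: t)
qed

lemma binary_leaves_1:
  assumes "wf_tree (\<lambda>_. 2) t" "leaves t = 1"
  shows "t = Leaf"
proof (rule ccontr)
  assume "t \<noteq> Leaf"
  with assms(1) obtain g s u where "t = Node g [s, u]" "wf_tree (\<lambda>_. 2) s" "wf_tree (\<lambda>_. 2) u"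
    "leaves t = leaves s + leaves u" "1 \<le> leaves s" "1 \<le> leaves u"
    by (rule binary_NodeE)
  with assms(2) show False by linarith
qed

lemma binary_leaves_2:
  assumes "wf_tree (\<lambda>_. 2) t" "leaves t = 2"
  obtains g where "t = Node g [Leaf, Leaf]"
proof -
  from assms(2) have "t \<noteq> Leaf" by auto
  with assms(1) obtain g s u where *: "t = Node g [s, u]" "wf_tree (\<lambda>_. 2) s" "wf_tree (\<lambda>_. 2) u"
    "leaves t = leaves s + leaves u" "1 \<le> leaves s" "1 \<le> leaves u"
    by (rule binary_NodeE)
  with assms have "leaves s = 1" "leaves u = 1" by linarith+
  with * have "s = Leaf" "u = Leaf" by (simp_all add: binary_leaves_1)
  with * that show ?thesis by simp
qed

lemma binary_leaves_3:
  assumes "wf_tree (\<lambda>_. 2) t" "leaves t = 3"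
  obtains a b where "t = Node b [Node a [Leaf, Leaf], Leaf]"
  | c d where "t = Node c [Leaf, Node d [Leaf, Leaf]]"
proof -
  from assms(2) have "t \<noteq> Leaf" by auto
  with assms(1) obtain g s u where *: "t = Node g [s, u]" "wf_tree (\<lambda>_. 2) s" "wf_tree (\<lambda>_. 2) u"
    "leaves t = leaves s + leaves u" "1 \<le> leaves s" "1 \<le> leaves u"
    by (rule binary_NodeE)
  with assms consider "leaves s = 2" "leaves u = 1" | "leaves s = 1" "leaves u = 2" by linarith
  then show ?thesis
  proof cases
    case 1
    with * have "u = Leaf" by (simp add: binary_leaves_1)
    moreover obtain a where "s = Node a [Leaf, Leaf]" using binary_leaves_2[OF *(2) 1(1)] .
    ultimately show ?thesis using * that by blast
  next
    case 2
    with * have "s = Leaf" by (simp add: binary_leaves_1)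
    moreover obtain a where "u = Node a [Leaf, Leaf]" using binary_leaves_2[OF *(3) 2(2)] .
    ultimately show ?thesis using * that by blast
  qed
qed

lemma lookup_quadratic_relation:
  fixes p :: "('v, 'k::field) tensor_pair"
  shows
  "Poly_Mapping.lookup (quadratic_relation p) (Node b [Node a [Leaf, Leaf], Leaf]) = Poly_Mapping.lookup (fst p) (a, b)"
  "Poly_Mapping.lookup (quadratic_relation p) (Node c [Leaf, Node d [Leaf, Leaf]]) = - Poly_Mapping.lookup (snd p) (c, d)"
proof -
  define L where "L = (\<lambda>(a, b). Node b [Node a [Leaf, Leaf], Leaf :: 'v tree])"
  define R where "R = (\<lambda>(c, d). Node c [Leaf :: 'v tree, Node d [Leaf, Leaf]])"
  have inj: "inj L" "inj R" and ne: "L x \<noteq> R y" for x y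
    by (auto simp: L_def R_def inj_on_def split: prod.splits)
  have rel: "quadratic_relation p = linear_ext (\<lambda>b. lc_basis (L b)) (fst p) - linear_ext (\<lambda>b. lc_basis (R b)) (snd p)"
    unfolding quadratic_relation_def bin_gen_comp L_def R_def by (simp add: case_prod_unfold)
  have "Poly_Mapping.lookup (quadratic_relation p) (L (a, b)) = Poly_Mapping.lookup (fst p) (a, b)"
    unfolding rel lookup_minus using inj ne
    by (simp add: lookup_linear_ext_inj lookup_linear_ext_notin)
  moreover have "Poly_Mapping.lookup (quadratic_relation p) (R (c, d)) = - Poly_Mapping.lookup (snd p) (c, d)"
    unfolding rel lookup_minus using inj not_sym[OF ne]
    by (simp add: lookup_linear_ext_inj lookup_linear_ext_notin)
  ultimately show
    "Poly_Mapping.lookup (quadratic_relation p) (Node b [Node a [Leaf, Leaf], Leaf]) = Poly_Mapping.lookup (fst p) (a, b)"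
    "Poly_Mapping.lookup (quadratic_relation p) (Node c [Leaf, Node d [Leaf, Leaf]]) = - Poly_Mapping.lookup (snd p) (c, d)"
    by (simp_all add: L_def R_def)
qed

lemma quadratic_relation_closed: "quadratic_relation p \<in> op_space free_binary 3"
proof -
  have "t \<in> {Node b [Node a [Leaf, Leaf], Leaf] | a b. True} \<union> {Node c [Leaf, Node d [Leaf, Leaf]] | c d. True}"
    if "t \<in> Poly_Mapping.keys (quadratic_relation p)" for t
    using that unfolding quadratic_relation_def bin_gen_comp
    by (auto simp: lc_basis_def dest!: subsetD[OF keys_diff] subsetD[OF keys_linear_ext])
  then show ?thesis by (fastforce simp: free_operad_def)
qed

lemma bij_betw_quadratic_relation:
  "bij_betw (quadratic_relation :: ('v, 'k::field) tensor_pair \<Rightarrow> _) UNIV (op_space free_binary 3)"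
proof (rule bij_betw_imageI)
  show "inj (quadratic_relation :: ('v, 'k) tensor_pair \<Rightarrow> _)"
  proof (rule injI)
    fix p q :: "('v, 'k) tensor_pair" assume eq: "quadratic_relation p = quadratic_relation q"
    have "fst p = fst q" "snd p = snd q"
      by (rule poly_mapping_eqI, use lookup_quadratic_relation[of p] lookup_quadratic_relation[of q] eq in force)+
    then show "p = q" by (simp add: prod_eq_iff)
  qed
  show "range (quadratic_relation :: ('v, 'k) tensor_pair \<Rightarrow> _) = op_space free_binary 3"
  proof (intro subset_antisym subsetI)
    fix x :: "'v tree \<Rightarrow>\<^sub>0 'k" assume x: "x \<in> op_space free_binary 3"
    define L where "L = (\<lambda>(a, b). Node b [Node a [Leaf, Leaf], Leaf :: 'v tree])"
    define R where "R = (\<lambda>(c, d). Node c [Leaf :: 'v tree, Node d [Leaf, Leaf]])"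
    have inj: "inj L" "inj R" by (auto simp: L_def R_def inj_on_def)
    define p where "p = (Poly_Mapping.map_key L x, - Poly_Mapping.map_key R x)"
    have p: "Poly_Mapping.lookup (fst p) ab = Poly_Mapping.lookup x (L ab)"
      "Poly_Mapping.lookup (snd p) ab = - Poly_Mapping.lookup x (R ab)" for ab
      by (simp_all add: p_def map_key.rep_eq[OF inj(1)] map_key.rep_eq[OF inj(2)])
    have "x = quadratic_relation p"
    proof (rule poly_mapping_eqI)
      fix t
      consider "t \<notin> Poly_Mapping.keys x" "t \<notin> Poly_Mapping.keys (quadratic_relation p)"
        | "wf_tree (\<lambda>_. 2) t" "leaves t = 3"
        using x quadratic_relation_closed[of p] by (auto simp: free_operad_def)
      then show "Poly_Mapping.lookup x t = Poly_Mapping.lookup (quadratic_relation p) t"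
      proof cases
        case 1
        then show ?thesis by (simp add: in_keys_iff)
      next
        case 2
        then show ?thesis
          by (elim binary_leaves_3)
            (simp_all add: lookup_quadratic_relation p L_def R_def)
      qed
    qed
    then show "x \<in> range quadratic_relation" by blast
  qed (auto simp: quadratic_relation_closed)
qed

definition quadratic_operad ::
  "('v, 'k::field) tensor_pair set \<Rightarrow> ('k, ('v tree \<Rightarrow>\<^sub>0 'k) set) operad" where
  "quadratic_operad \<Lambda> = operad_mod free_binary 3 (quadratic_relation ` \<Lambda>)"

lemma ns_operad_quadratic: "ns_operad (quadratic_operad \<Lambda>)"
proof -
  interpret F: ns_operad free_binary by (rule ns_operad_free)
  have "operad_ideal free_binary (generated_ideal free_binary (\<lambda>m. if m = 3 then quadratic_relation ` \<Lambda> else {}))"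
    by (rule F.generated_ideal_is_ideal) (auto simp: quadratic_relation_closed)
  then interpret operad_with_ideal free_binary
    "generated_ideal free_binary (\<lambda>m. if m = 3 then quadratic_relation ` \<Lambda> else {})"
    by unfold_locales
  show ?thesis unfolding quadratic_operad_def operad_mod_def by (rule ns_operad_quotient)
qed

section \<open>Extended tridendriform algebras\<close>

datatype tri = Prec | Succ | Bullet

definition tri_prec :: "tri \<Rightarrow>\<^sub>0 'k::field" ("\<prec>\<^sub>V") where "\<prec>\<^sub>V = lc_basis Prec"
definition tri_succ :: "tri \<Rightarrow>\<^sub>0 'k::field" ("\<succ>\<^sub>V") where "\<succ>\<^sub>V = lc_basis Succ"
definition tri_bullet :: "tri \<Rightarrow>\<^sub>0 'k::field" ("\<bullet>\<^sub>V") where "\<bullet>\<^sub>V = lc_basis Bullet"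

definition tri_star :: "'k::field \<Rightarrow> (tri \<Rightarrow>\<^sub>0 'k)" where
  "tri_star lam = \<prec>\<^sub>V + \<succ>\<^sub>V + lam \<cdot>\<^sub>k \<bullet>\<^sub>V"

definition Lambda_ETD :: "'k::field \<Rightarrow> 'k \<Rightarrow> (tri, 'k) tensor_pair set" where
  "Lambda_ETD lam kap = module.span pair_scale
     {(\<prec>\<^sub>V \<otimes>\<^sub>k \<prec>\<^sub>V, \<prec>\<^sub>V \<otimes>\<^sub>k tri_star lam + kap \<cdot>\<^sub>k (\<bullet>\<^sub>V \<otimes>\<^sub>k \<bullet>\<^sub>V)),
      (\<succ>\<^sub>V \<otimes>\<^sub>k \<prec>\<^sub>V, \<succ>\<^sub>V \<otimes>\<^sub>k \<prec>\<^sub>V),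
      (tri_star lam \<otimes>\<^sub>k \<succ>\<^sub>V + kap \<cdot>\<^sub>k (\<bullet>\<^sub>V \<otimes>\<^sub>k \<bullet>\<^sub>V), \<succ>\<^sub>V \<otimes>\<^sub>k \<succ>\<^sub>V),
      (\<succ>\<^sub>V \<otimes>\<^sub>k \<bullet>\<^sub>V, \<succ>\<^sub>V \<otimes>\<^sub>k \<bullet>\<^sub>V),
      (\<prec>\<^sub>V \<otimes>\<^sub>k \<bullet>\<^sub>V, \<bullet>\<^sub>V \<otimes>\<^sub>k \<succ>\<^sub>V),
      (\<bullet>\<^sub>V \<otimes>\<^sub>k \<prec>\<^sub>V, \<bullet>\<^sub>V \<otimes>\<^sub>k \<prec>\<^sub>V),
      (\<bullet>\<^sub>V \<otimes>\<^sub>k \<bullet>\<^sub>V, \<bullet>\<^sub>V \<otimes>\<^sub>k \<bullet>\<^sub>V)}"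

definition ETD :: "'k::field \<Rightarrow> 'k \<Rightarrow> ('k, (tri tree \<Rightarrow>\<^sub>0 'k) set) operad" where
  "ETD lam kap = quadratic_operad (Lambda_ETD lam kap)"

section \<open>Extended Rota-Baxter algebras\<close>

datatype rb = Rho | Mu

fun rb_arity :: "rb \<Rightarrow> nat" where
  "rb_arity Rho = 1"
| "rb_arity Mu = 2"

definition free_rho :: "rb tree \<Rightarrow>\<^sub>0 'k::field" where "free_rho = op_gen rb_arity Rho"
definition free_mu :: "rb tree \<Rightarrow>\<^sub>0 'k::field" where "free_mu = op_gen rb_arity Mu"

definition assoc_relation :: "rb tree \<Rightarrow>\<^sub>0 'k::field" where
  "assoc_relation = free_mu \<circ>\<^bsub>1\<^esub> free_mu - free_mu \<circ>\<^bsub>2\<^esub> free_mu"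

definition erb_relation :: "'k::field \<Rightarrow> 'k \<Rightarrow> (rb tree \<Rightarrow>\<^sub>0 'k)" where
  "erb_relation lam kap =
     (free_mu \<circ>\<^bsub>1\<^esub> free_rho) \<circ>\<^bsub>2\<^esub> free_rho
     - free_rho \<circ>\<^bsub>1\<^esub> (free_mu \<circ>\<^bsub>2\<^esub> free_rho)
     - free_rho \<circ>\<^bsub>1\<^esub> (free_mu \<circ>\<^bsub>1\<^esub> free_rho)
     - lam \<cdot>\<^sub>k (free_rho \<circ>\<^bsub>1\<^esub> free_mu)
     - kap \<cdot>\<^sub>k free_mu"

lemma erb_relations_closed:
  "assoc_relation \<in> op_space (free_operad rb_arity) 3"
  "erb_relation lam kap \<in> op_space (free_operad rb_arity) 2"
  unfolding assoc_relation_def erb_relation_def free_rho_def free_mu_def op_gen_def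
  by (auto simp: lc_basis_comp free_operad_def eval_nat_numeral
      dest!: subsetD[OF keys_diff] subsetD[OF keys_lc_scale])
    (auto simp: lc_basis_def)

definition ERB_ideal :: "'k::field \<Rightarrow> 'k \<Rightarrow> nat \<Rightarrow> (rb tree \<Rightarrow>\<^sub>0 'k) set" where
  "ERB_ideal lam kap = generated_ideal (free_operad rb_arity)
     (\<lambda>n. if n = 3 then {assoc_relation} else if n = 2 then {erb_relation lam kap} else {})"

definition ERB :: "'k::field \<Rightarrow> 'k \<Rightarrow> ('k, (rb tree \<Rightarrow>\<^sub>0 'k) set) operad" where
  "ERB lam kap = operad_quotient (free_operad rb_arity) (ERB_ideal lam kap)"

lemma ns_operad_ERB: "ns_operad (ERB lam kap)"
proof -
  interpret F: ns_operad "free_operad rb_arity" by (rule ns_operad_free)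
  interpret operad_with_ideal "free_operad rb_arity" "ERB_ideal lam kap"
    by unfold_locales
      (unfold ERB_ideal_def, rule F.generated_ideal_is_ideal, simp add: erb_relations_closed)
  show ?thesis unfolding ERB_def by (rule ns_operad_quotient)
qed

definition ERB_rho :: "'k::field \<Rightarrow> 'k \<Rightarrow> (rb tree \<Rightarrow>\<^sub>0 'k) set" where
  "ERB_rho lam kap = operad_coset (free_operad rb_arity) (ERB_ideal lam kap) 1 free_rho"

definition ERB_mu :: "'k::field \<Rightarrow> 'k \<Rightarrow> (rb tree \<Rightarrow>\<^sub>0 'k) set" where
  "ERB_mu lam kap = operad_coset (free_operad rb_arity) (ERB_ideal lam kap) 2 free_mu"

section \<open>The tri-companion\<close>

text \<open>\<open>\<rho>\<close> and \<open>\<mu>\<close> are the unary and the binary generator of \<open>Q\<close>.\<close>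

definition is_tri_hom :: "('k::field, 'a) operad \<Rightarrow> 'a \<Rightarrow> 'a \<Rightarrow> (nat \<Rightarrow> (tri tree \<Rightarrow>\<^sub>0 'k) \<Rightarrow> 'a) \<Rightarrow> bool" where
  "is_tri_hom Q \<rho> \<mu> \<Phi> \<longleftrightarrow> \<Phi> \<in> operad_hom free_binary Q \<and>
     \<Phi> 2 (bin_gen Prec) = op_comp Q 2 1 2 \<mu> \<rho> \<and>
     \<Phi> 2 (bin_gen Succ) = op_comp Q 2 1 1 \<mu> \<rho> \<and>
     \<Phi> 2 (bin_gen Bullet) = \<mu>"

definition tri_hom :: "('k::field, 'a) operad \<Rightarrow> 'a \<Rightarrow> 'a \<Rightarrow> nat \<Rightarrow> (tri tree \<Rightarrow>\<^sub>0 'k) \<Rightarrow> 'a" where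
  "tri_hom Q \<rho> \<mu> = (THE \<Phi>. is_tri_hom Q \<rho> \<mu> \<Phi>)"

definition tri_companion ::
  "('k::field, 'a) operad \<Rightarrow> 'a \<Rightarrow> 'a \<Rightarrow> ('k, (tri tree \<Rightarrow>\<^sub>0 'k) set) operad" where
  "tri_companion Q \<rho> \<mu> =
     operad_mod free_binary 3 (operad_kernel free_binary Q (tri_hom Q \<rho> \<mu>) 3 \<inter> range quadratic_relation)"

end

theory Submission
  imports Defs
begin

text \<open>
  Write \<open>R\<close> for the operation \<open>\<rho>\<close> of an extended Rota-Baxter algebra. The homomorphism sends each
  generator to one tree (\<open>x \<prec> y = x R(y)\<close>, \<open>x \<succ> y = R(x) y\<close>, \<open>x \<bullet> y = x y\<close>), so it exists as the linear
  extension of a map of trees, and it is unique because trees generate the free operad. The claim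
  on the kernel compares the 18 monomials of arity three in \<open>\<prec>, \<succ>, \<bullet>\<close>.

  The seven relations hold (lemma \<open>Lambda_ETD_in_ERB_ideal\<close>): each is associativity of \<open>\<mu>\<close> with some
  inputs replaced by \<open>R\<close>, where a product \<open>R(x) R(y)\<close> is rewritten by the Rota-Baxter relation.

  That there are no others needs models of the Rota-Baxter relation that separate enough
  monomials. Let \<open>a\<close> be an element of a unital associative algebra with \<open>a\<^sup>2 = - \<lambda> a - \<kappa>\<close>.
  Then \<open>R(x) = a x\<close> is an extended Rota-Baxter operator of weight \<open>(\<lambda>, \<kappa>)\<close>, since
  \<open>a x a y - a (x a y) - a (a x y) - \<lambda> a x y - \<kappa> x y = - (a\<^sup>2 + \<lambda> a + \<kappa>) x y = 0\<close>, and so is \<open>R(x) = x a\<close>.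
  Neither model alone is enough: with \<open>R(x) = a x\<close>, for instance, the monomial \<open>x R(R(y) z) = x a\<^sup>2 y z\<close> is
  a combination of \<open>x R(y z)\<close> and \<open>x y z\<close>. Together they give eleven independent linear
  conditions on the 18 coefficients of a relation (lemma \<open>ERB_ideal_imp_Lambda_ETD\<close>), which leaves
  the span of the seven relations.

  In these models with free variables \<open>x\<^sub>1, \<dots>, x\<^sub>n\<close>, a tree takes the value
  \<open>a\<^bsup>e\<^sub>1\<^esup> x\<^sub>1 \<dots> a\<^bsup>e\<^sub>n\<^esup> x\<^sub>n\<close> or \<open>x\<^sub>1 a\<^bsup>e\<^sub>1\<^esup> \<dots> x\<^sub>n a\<^bsup>e\<^sub>n\<^esup>\<close>, so it is recorded by a list of exponents. A linear
  form on \<open>k[a] / (a\<^sup>2 + \<lambda> a + \<kappa>)\<close> is a sequence \<open>f\<close> with \<open>f (k + 2) = - \<lambda> f (k + 1) - \<kappa> f k\<close>, its values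
  on the powers of \<open>a\<close>. The identities of a model are thus the combinations of trees that are killed by all
  products of such sequences evaluated at the exponents. They form an ideal
  (lemma \<open>operad_ideal_weight_kernel\<close>) that contains the defining relations of extended Rota-Baxter
  algebras, hence the ideal that these generate.
\<close>

section \<open>Homomorphisms out of a free binary operad\<close>

lemma lc_basis_closed:
  "wf_tree ar t \<Longrightarrow> lc_basis t \<in> op_space (free_operad ar) (leaves t)"
  by (simp add: free_operad_def lc_basis_def)

lemma free_operad_sels:
  "op_zero (free_operad ar) n = 0"
  "op_add (free_operad ar) n = (+)"
  "op_scale (free_operad ar) n = (\<cdot>\<^sub>k)"
  "op_comp (free_operad ar) m n i x y = x \<circ>\<^bsub>i\<^esub> y"
  "op_id (free_operad ar) = lc_basis Leaf"
  by (simp_all add: free_operad_def)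

lemma operad_homD:
  assumes "f \<in> operad_hom P Q"
  shows "f n \<in> op_space P n \<rightarrow>\<^sub>E op_space Q n"
    and "x \<in> op_space P n \<Longrightarrow> f n x \<in> op_space Q n"
    and "\<lbrakk>x \<in> op_space P n; y \<in> op_space P n\<rbrakk> \<Longrightarrow> f n (op_add P n x y) = op_add Q n (f n x) (f n y)"
    and "x \<in> op_space P n \<Longrightarrow> f n (op_scale P n c x) = op_scale Q n c (f n x)"
    and "\<lbrakk>x \<in> op_space P m; y \<in> op_space P n; 1 \<le> i; i \<le> m\<rbrakk>
      \<Longrightarrow> f (m + n - 1) (op_comp P m n i x y) = op_comp Q m n i (f m x) (f n y)"
    and "f 1 (op_id P) = op_id Q"
proof -
  note * = assms[unfolded operad_hom_def mem_Collect_eq]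
  show "f n \<in> op_space P n \<rightarrow>\<^sub>E op_space Q n" using * by blast
  then show "x \<in> op_space P n \<Longrightarrow> f n x \<in> op_space Q n" by blast
  show "\<lbrakk>x \<in> op_space P n; y \<in> op_space P n\<rbrakk> \<Longrightarrow> f n (op_add P n x y) = op_add Q n (f n x) (f n y)"
    using * by blast
  show "x \<in> op_space P n \<Longrightarrow> f n (op_scale P n c x) = op_scale Q n c (f n x)"
    using * by blast
  show "\<lbrakk>x \<in> op_space P m; y \<in> op_space P n; 1 \<le> i; i \<le> m\<rbrakk>
      \<Longrightarrow> f (m + n - 1) (op_comp P m n i x y) = op_comp Q m n i (f m x) (f n y)"
    using * by blast
  show "f 1 (op_id P) = op_id Q" using * by blast
qed

lemma (in ns_operad) scale_zero_left: "x \<in> op_space P n \<Longrightarrow> op_scale P n 0 x = op_zero P n"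
  using add_scale[of x n 1 "-1"] by (simp add: scale_one add_minus)

lemma operad_hom_zero:
  fixes Q :: "('k::field, 'b) operad" and P :: "('k, 'a) operad"
  assumes "ns_operad P" "ns_operad Q" "f \<in> operad_hom P Q"
  shows "f n (op_zero P n) = op_zero Q n"
proof -
  interpret P: ns_operad P by fact
  interpret Q: ns_operad Q by fact
  have "f n (op_scale P n 0 (op_zero P n)) = op_scale Q n 0 (f n (op_zero P n))"
    by (intro operad_homD(4)[OF assms(3)] P.zero_closed)
  then show ?thesis
    by (simp add: P.scale_zero_left P.zero_closed Q.scale_zero_left operad_homD(2)[OF assms(3)])
qed

text \<open>
  A homomorphism is linear, so it is determined by its values on trees, and every binary tree is
  built from corollas by \<open>Node g [s, u] = (g \<circ>\<^sub>2 u) \<circ>\<^sub>1 s\<close>.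
\<close>

lemma free_binary_hom_eqI:
  fixes Q :: "('k::field, 'b) operad" and f f' :: "nat \<Rightarrow> ('v tree \<Rightarrow>\<^sub>0 'k) \<Rightarrow> 'b"
  assumes Q: "ns_operad Q"
    and hom: "f \<in> operad_hom free_binary Q" "f' \<in> operad_hom free_binary Q"
    and gen: "\<And>g. f 2 (bin_gen g) = f' 2 (bin_gen g)"
  shows "f = f'"
proof -
  let ?F = "free_binary :: ('k, 'v tree \<Rightarrow>\<^sub>0 'k) operad"
  have on_tree: "f (leaves t) (lc_basis t) = f' (leaves t) (lc_basis t)"
    if "wf_tree (\<lambda>_. 2) t" for t
    using that
  proof (induction t)
    case Leaf
    show ?case
      using operad_homD(6)[OF hom(1)] operad_homD(6)[OF hom(2)] by (simp add: free_operad_sels)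
  next
    case (Node g ts)
    from Node.prems obtain s u where ts: "ts = [s, u]"
      and wf: "wf_tree (\<lambda>_. 2) s" "wf_tree (\<lambda>_. 2) u"
      by (rule wf_binary_Node)
    let ?b = "bin_gen g :: 'v tree \<Rightarrow>\<^sub>0 'k"
    let ?s = "lc_basis s :: 'v tree \<Rightarrow>\<^sub>0 'k" and ?u = "lc_basis u :: 'v tree \<Rightarrow>\<^sub>0 'k"
    have b: "?b \<in> op_space ?F 2"
      by (simp add: op_gen_def free_operad_def lc_basis_def eval_nat_numeral)
    have s: "?s \<in> op_space ?F (leaves s)" and u: "?u \<in> op_space ?F (leaves u)"
      using wf by (simp_all add: lc_basis_closed)
    have bu: "op_comp ?F 2 (leaves u) 2 ?b ?u \<in> op_space ?F (2 + leaves u - 1)"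
      by (rule ns_operad.comp_closed[OF ns_operad_free b u]) simp_all
    have decomp: "lc_basis (Node g ts)
        = op_comp ?F (2 + leaves u - 1) (leaves s) 1 (op_comp ?F 2 (leaves u) 2 ?b ?u) ?s"
      by (simp add: free_operad_sels op_gen_def lc_basis_comp ts eval_nat_numeral)
    have arity: "leaves (Node g ts) = 2 + leaves u - 1 + leaves s - 1"
      by (simp add: ts)
    have on_node: "h (leaves (Node g ts)) (lc_basis (Node g ts))
        = op_comp Q (2 + leaves u - 1) (leaves s) 1
            (op_comp Q 2 (leaves u) 2 (h 2 ?b) (h (leaves u) ?u)) (h (leaves s) ?s)"
      if h: "h \<in> operad_hom ?F Q" for h
    proof -
      have "h (2 + leaves u - 1) (op_comp ?F 2 (leaves u) 2 ?b ?u)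
          = op_comp Q 2 (leaves u) 2 (h 2 ?b) (h (leaves u) ?u)"
        by (rule operad_homD(5)[OF h b u]) simp_all
      moreover have "1 \<le> 2 + leaves u - 1" by simp
      ultimately show ?thesis
        unfolding decomp arity by (simp only: operad_homD(5)[OF h bu s] order_refl)
    qed
    have "f (leaves s) ?s = f' (leaves s) ?s" "f (leaves u) ?u = f' (leaves u) ?u"
      using Node.IH ts wf by simp_all
    then show ?case by (simp only: on_node[OF hom(1)] on_node[OF hom(2)] gen)
  qed
  have "f n x = f' n x" if "x \<in> op_space ?F n" for n and x :: "'v tree \<Rightarrow>\<^sub>0 'k"
  proof -
    define S where "S A = (\<Sum>t\<in>A. Poly_Mapping.lookup x t \<cdot>\<^sub>k lc_basis t)" for A
    interpret F: ns_operad ?F by (rule ns_operad_free)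
    have "S A \<in> op_space ?F n \<and> f n (S A) = f' n (S A)"
      if "finite A" "A \<subseteq> Poly_Mapping.keys x" for A
      using that
    proof (induction A rule: finite_induct)
      case empty
      then show ?case
        using operad_hom_zero[OF ns_operad_free Q hom(1)] operad_hom_zero[OF ns_operad_free Q hom(2)]
          F.zero_closed[of n]
        by (simp add: S_def free_operad_sels)
    next
      case (insert t A)
      let ?t = "lc_basis t :: 'v tree \<Rightarrow>\<^sub>0 'k" and ?c = "Poly_Mapping.lookup x t"
      from insert \<open>x \<in> _\<close> have t: "wf_tree (\<lambda>_. 2) t" "leaves t = n"
        by (auto simp: free_operad_def)
      then have tc: "?t \<in> op_space ?F n" using lc_basis_closed by metis
      then have sc: "op_scale ?F n ?c ?t \<in> op_space ?F n" by (rule F.scale_closed)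
      from insert have IH: "S A \<in> op_space ?F n" "f n (S A) = f' n (S A)" by auto
      have S: "S (insert t A) = op_add ?F n (op_scale ?F n ?c ?t) (S A)"
        using insert by (simp add: S_def free_operad_sels)
      have "f n ?t = f' n ?t" using on_tree[OF t(1)] t(2) by simp
      then show ?case
        unfolding S using IH
        by (simp add: F.add_closed[OF sc IH(1)] operad_homD(3)[OF hom(1) sc IH(1)]
            operad_homD(3)[OF hom(2) sc IH(1)] operad_homD(4)[OF hom(1) tc] operad_homD(4)[OF hom(2) tc])
    qed
    from this[of "Poly_Mapping.keys x"] show ?thesis
      by (simp add: S_def linear_ext_lc_basis[unfolded linear_ext_def])
  qed
  then show ?thesis
    using operad_homD(1)[OF hom(1)] operad_homD(1)[OF hom(2)]
    by (intro ext) (metis PiE_arb)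
qed

section \<open>The homomorphism from tri-operations to extended Rota-Baxter operations\<close>

text \<open>
  Each generator is sent to a single tree, so the homomorphism lifts to a map of trees, followed by
  the projection onto the quotient. On lists that are not the children of a binary vertex, the last
  equation gives a default value.
\<close>

fun rb_node :: "tri \<Rightarrow> rb tree list \<Rightarrow> rb tree" where
  "rb_node Prec [s, u] = Node Mu [s, Node Rho [u]]"
| "rb_node Succ [s, u] = Node Mu [Node Rho [s], u]"
| "rb_node g ts = Node Mu ts"

fun expand :: "tri tree \<Rightarrow> rb tree" where
  "expand Leaf = Leaf"
| "expand (Node g ts) = rb_node g (map expand ts)"

definition expand_ext :: "(tri tree \<Rightarrow>\<^sub>0 'k::field) \<Rightarrow> (rb tree \<Rightarrow>\<^sub>0 'k)" where
  "expand_ext = linear_ext (\<lambda>t. lc_basis (expand t))"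

lemma expand_wf_leaves:
  "wf_tree (\<lambda>_. 2) t \<Longrightarrow> wf_tree rb_arity (expand t) \<and> leaves (expand t) = leaves t"
proof (induction t)
  case (Node g ts)
  from Node.prems obtain s u where "ts = [s, u]" "wf_tree (\<lambda>_. 2) s" "wf_tree (\<lambda>_. 2) u"
    by (rule wf_binary_Node)
  with Node.IH show ?case by (cases g) auto
qed simp

lemma expand_graft:
  "\<lbrakk>wf_tree (\<lambda>_. 2) t; 1 \<le> i; i \<le> leaves t\<rbrakk> \<Longrightarrow> expand (graft t i v) = graft (expand t) i (expand v)"
proof (induction t arbitrary: i)
  case (Node g ts)
  from Node.prems(1) obtain s u where "ts = [s, u]" "wf_tree (\<lambda>_. 2) s" "wf_tree (\<lambda>_. 2) u"
    by (rule wf_binary_Node)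
  with Node show ?case by (cases g) (auto simp: expand_wf_leaves)
qed simp

lemma expand_ext_closed:
  assumes "x \<in> op_space free_binary n"
  shows "expand_ext x \<in> op_space (free_operad rb_arity) n"
  using assms unfolding expand_ext_def
  by (auto simp: free_operad_def lc_basis_def expand_wf_leaves dest!: subsetD[OF keys_linear_ext])

lemma expand_ext_add: "expand_ext (x + y) = expand_ext x + expand_ext y"
  by (simp add: expand_ext_def linear_ext_add)

lemma expand_ext_scale: "expand_ext (c \<cdot>\<^sub>k x) = c \<cdot>\<^sub>k expand_ext x"
  by (simp add: expand_ext_def linear_ext_scale)

lemma expand_ext_basis: "expand_ext (lc_basis t) = lc_basis (expand t)"
  by (simp add: expand_ext_def)

lemma expand_ext_comp:
  assumes "x \<in> op_space free_binary m" "1 \<le> i" "i \<le> m"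
  shows "expand_ext (x \<circ>\<^bsub>i\<^esub> y) = expand_ext x \<circ>\<^bsub>i\<^esub> expand_ext y"
  using assms unfolding expand_ext_def tree_comp_def bilinear_ext_def linear_ext_comp
  by (auto simp: free_operad_def expand_graft intro!: linear_ext_cong)

lemma operad_with_ideal_ERB: "operad_with_ideal (free_operad rb_arity) (ERB_ideal lam kap)"
proof -
  interpret F: ns_operad "free_operad rb_arity" by (rule ns_operad_free)
  show ?thesis
    by unfold_locales
      (unfold ERB_ideal_def, rule F.generated_ideal_is_ideal, simp add: erb_relations_closed)
qed

definition tri_to_ERB ::
  "'k::field \<Rightarrow> 'k \<Rightarrow> nat \<Rightarrow> (tri tree \<Rightarrow>\<^sub>0 'k) \<Rightarrow> (rb tree \<Rightarrow>\<^sub>0 'k) set" where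
  "tri_to_ERB lam kap n =
     (\<lambda>x\<in>op_space free_binary n. operad_coset (free_operad rb_arity) (ERB_ideal lam kap) n (expand_ext x))"

lemma is_tri_hom_tri_to_ERB:
  fixes lam kap :: "'k::field"
  shows "is_tri_hom (ERB lam kap) (ERB_rho lam kap) (ERB_mu lam kap) (tri_to_ERB lam kap)"
proof -
  let ?B = "free_binary :: ('k, tri tree \<Rightarrow>\<^sub>0 'k) operad"
  let ?R = "free_operad rb_arity :: ('k, rb tree \<Rightarrow>\<^sub>0 'k) operad"
  interpret B: ns_operad ?B by (rule ns_operad_free)
  interpret R: operad_with_ideal ?R "ERB_ideal lam kap" by (rule operad_with_ideal_ERB)
  have gen: "(bin_gen g :: tri tree \<Rightarrow>\<^sub>0 'k) \<in> op_space ?B 2" for g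
    by (simp add: op_gen_def free_operad_def lc_basis_def eval_nat_numeral)
  have rho: "(free_rho :: rb tree \<Rightarrow>\<^sub>0 'k) \<in> op_space ?R 1" and mu: "(free_mu :: rb tree \<Rightarrow>\<^sub>0 'k) \<in> op_space ?R 2"
    by (simp_all add: free_rho_def free_mu_def op_gen_def free_operad_def lc_basis_def eval_nat_numeral)
  have comp: "tri_to_ERB lam kap (m + n - 1) (op_comp ?B m n i x y)
      = op_comp (ERB lam kap) m n i (tri_to_ERB lam kap m x) (tri_to_ERB lam kap n y)"
    if "x \<in> op_space ?B m" "y \<in> op_space ?B n" "1 \<le> i \<and> i \<le> m" for m n i x y
    using that B.comp_closed[OF that(1,2), of i]
    by (simp add: tri_to_ERB_def ERB_def R.quo_comp[simplified] expand_ext_closed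
        free_operad_sels expand_ext_comp)
  have "tri_to_ERB lam kap \<in> operad_hom ?B (ERB lam kap)"
    unfolding operad_hom_def mem_Collect_eq
  proof (intro conjI allI ballI impI)
    fix m n i and x y :: "tri tree \<Rightarrow>\<^sub>0 'k"
    assume "x \<in> op_space ?B m" "y \<in> op_space ?B n" "1 \<le> i \<and> i \<le> m"
    then show "tri_to_ERB lam kap (m + n - 1) (op_comp ?B m n i x y)
      = op_comp (ERB lam kap) m n i (tri_to_ERB lam kap m x) (tri_to_ERB lam kap n y)"
      by (rule comp)
  next
    fix n c and x y :: "tri tree \<Rightarrow>\<^sub>0 'k"
    show "tri_to_ERB lam kap n \<in> op_space ?B n \<rightarrow>\<^sub>E op_space (ERB lam kap) n"
      by (auto simp: tri_to_ERB_def ERB_def R.quo_space expand_ext_closed)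
    assume x: "x \<in> op_space ?B n"
    show "tri_to_ERB lam kap n (op_scale ?B n c x) = op_scale (ERB lam kap) n c (tri_to_ERB lam kap n x)"
      using x B.scale_closed[OF x, of c]
      by (simp add: tri_to_ERB_def ERB_def R.quo_scale expand_ext_closed expand_ext_scale free_operad_sels)
    assume y: "y \<in> op_space ?B n"
    show "tri_to_ERB lam kap n (op_add ?B n x y)
        = op_add (ERB lam kap) n (tri_to_ERB lam kap n x) (tri_to_ERB lam kap n y)"
      using x y B.add_closed[OF x y]
      by (simp add: tri_to_ERB_def ERB_def R.quo_add expand_ext_closed expand_ext_add free_operad_sels)
  next
    show "tri_to_ERB lam kap 1 (op_id ?B) = op_id (ERB lam kap)"
      using B.id_closed
      by (simp add: tri_to_ERB_def ERB_def R.quo_id free_operad_sels expand_ext_basis)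
  qed
  moreover have "expand_ext (bin_gen Prec) = free_mu \<circ>\<^bsub>2\<^esub> (free_rho :: rb tree \<Rightarrow>\<^sub>0 'k)"
    "expand_ext (bin_gen Succ) = free_mu \<circ>\<^bsub>1\<^esub> (free_rho :: rb tree \<Rightarrow>\<^sub>0 'k)"
    "expand_ext (bin_gen Bullet) = (free_mu :: rb tree \<Rightarrow>\<^sub>0 'k)"
    by (simp_all add: op_gen_def free_mu_def free_rho_def expand_ext_basis lc_basis_comp eval_nat_numeral)
  ultimately show ?thesis
    unfolding is_tri_hom_def ERB_mu_def ERB_rho_def
    using R.quo_comp[OF mu rho, of 1] R.quo_comp[OF mu rho, of 2]
    by (simp add: tri_to_ERB_def gen ERB_def free_operad_sels)
qed

lemma tri_to_ERB_kernel_iff: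
  "x \<in> operad_kernel free_binary (ERB lam kap) (tri_to_ERB lam kap) n
    \<longleftrightarrow> x \<in> op_space free_binary n \<and> expand_ext x \<in> ERB_ideal lam kap n"
proof (cases "x \<in> op_space free_binary n")
  case True
  let ?R = "free_operad rb_arity"
  interpret R: operad_with_ideal ?R "ERB_ideal lam kap" by (rule operad_with_ideal_ERB)
  have z: "R.cls n 0 = ERB_ideal lam kap n"
    by (simp add: operad_coset_def free_operad_sels)
  have "R.cls n (expand_ext x) = R.cls n 0 \<longleftrightarrow> expand_ext x \<in> ERB_ideal lam kap n"
  proof
    assume "R.cls n (expand_ext x) = R.cls n 0"
    with R.cls_self[OF expand_ext_closed[OF True]] z show "expand_ext x \<in> ERB_ideal lam kap n" by simp
  next
    assume "expand_ext x \<in> ERB_ideal lam kap n"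
    from R.cls_add_ideal[OF R.zero_closed this] show "R.cls n (expand_ext x) = R.cls n 0"
      by (simp add: free_operad_sels)
  qed
  with True show ?thesis
    by (simp add: operad_kernel_def tri_to_ERB_def ERB_def R.quo_zero free_operad_sels)
qed (simp add: operad_kernel_def)

section \<open>The relations of extended tridendriform algebras hold\<close>

lemma tree_comp_linear:
  "(x + x') \<circ>\<^bsub>i\<^esub> y = x \<circ>\<^bsub>i\<^esub> y + x' \<circ>\<^bsub>i\<^esub> y"
  "x \<circ>\<^bsub>i\<^esub> (y + y') = x \<circ>\<^bsub>i\<^esub> y + x \<circ>\<^bsub>i\<^esub> y'"
  "(c \<cdot>\<^sub>k x) \<circ>\<^bsub>i\<^esub> y = c \<cdot>\<^sub>k (x \<circ>\<^bsub>i\<^esub> y)"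
  "x \<circ>\<^bsub>i\<^esub> (c \<cdot>\<^sub>k y) = c \<cdot>\<^sub>k (x \<circ>\<^bsub>i\<^esub> y)"
  by (simp_all add: tree_comp_def bilinear_ext_def linear_ext_add linear_ext_scale
      linear_ext_add_fun linear_ext_scale_fun)

lemma tree_comp_diff:
  "(x - x') \<circ>\<^bsub>i\<^esub> y = x \<circ>\<^bsub>i\<^esub> y - x' \<circ>\<^bsub>i\<^esub> y"
  "x \<circ>\<^bsub>i\<^esub> (y - y') = x \<circ>\<^bsub>i\<^esub> y - x \<circ>\<^bsub>i\<^esub> y'"
  using tree_comp_linear(1)[of "x - x'" x' i y] tree_comp_linear(2)[of x i "y - y'" y']
  by (simp_all only: diff_add_cancel eq_diff_eq)

lemma expand_ext_diff: "expand_ext (x - y) = expand_ext x - expand_ext y"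
  using expand_ext_add[of "x - y" y] by simp

lemma quadratic_relation_add: "quadratic_relation (p + q) = quadratic_relation p + quadratic_relation q"
  by (simp add: quadratic_relation_def linear_ext_add)

lemma quadratic_relation_scale: "quadratic_relation (pair_scale c p) = c \<cdot>\<^sub>k quadratic_relation p"
  by (simp add: quadratic_relation_def pair_scale_def linear_ext_scale lc.scale_right_diff_distrib)

lemma tensor_linear:
  "(u + u') \<otimes>\<^sub>k v = u \<otimes>\<^sub>k v + u' \<otimes>\<^sub>k v"
  "u \<otimes>\<^sub>k (v + v') = u \<otimes>\<^sub>k v + u \<otimes>\<^sub>k v'"
  "(c \<cdot>\<^sub>k u) \<otimes>\<^sub>k v = c \<cdot>\<^sub>k (u \<otimes>\<^sub>k v)"
  "u \<otimes>\<^sub>k (c \<cdot>\<^sub>k v) = c \<cdot>\<^sub>k (u \<otimes>\<^sub>k v)"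
  by (simp_all add: tensor_def bilinear_ext_def linear_ext_add linear_ext_scale
      linear_ext_add_fun linear_ext_scale_fun)

lemma tensor_basis: "lc_basis a \<otimes>\<^sub>k lc_basis b = lc_basis (a, b)"
  by (simp add: tensor_def bilinear_ext_def)

lemma lookup_lc_basis: "Poly_Mapping.lookup (lc_basis a) b = (if a = b then 1 else 0)"
  by (simp add: lc_basis_def lookup_single when_def)

lemmas tri_tensor = tri_star_def tri_prec_def tri_succ_def tri_bullet_def tensor_linear tensor_basis

lemma expand_quadratic_relation:
  "expand_ext (quadratic_relation p)
    = linear_ext (\<lambda>(a, b). lc_basis (expand (Node b [Node a [Leaf, Leaf], Leaf]))) (fst p)
    - linear_ext (\<lambda>(c, d). lc_basis (expand (Node c [Leaf, Node d [Leaf, Leaf]]))) (snd p)"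
  unfolding quadratic_relation_def bin_gen_comp expand_ext_diff
  by (simp add: expand_ext_def linear_ext_comp case_prod_unfold)

text \<open>
  All seven relations come from associativity of \<open>\<mu>\<close> with \<open>\<rho>\<close> composed into some of its inputs;
  the first and the third use in addition the Rota-Baxter relation, composed
  into the second or the first input of \<open>\<mu>\<close>, to rewrite \<open>\<rho>(y) \<rho>(z)\<close> or \<open>\<rho>(x) \<rho>(y)\<close>.
\<close>

lemma Lambda_ETD_in_ERB_ideal:
  fixes lam kap :: "'k::field"
  assumes "p \<in> Lambda_ETD lam kap"
  shows "expand_ext (quadratic_relation p) \<in> ERB_ideal lam kap 3"
proof -
  let ?R = "free_operad rb_arity :: ('k, rb tree \<Rightarrow>\<^sub>0 'k) operad" and ?I = "ERB_ideal lam kap"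
  interpret R: operad_with_ideal ?R ?I by (rule operad_with_ideal_ERB)
  define A where "A = (assoc_relation :: rb tree \<Rightarrow>\<^sub>0 'k)"
  define E where "E = erb_relation lam kap"
  define r where "r = (free_rho :: rb tree \<Rightarrow>\<^sub>0 'k)"
  define m where "m = (free_mu :: rb tree \<Rightarrow>\<^sub>0 'k)"
  have A: "A \<in> ?I 3" and E: "E \<in> ?I 2"
    unfolding A_def E_def ERB_ideal_def generated_ideal_iff by force+
  have r: "r \<in> op_space ?R 1" and m: "m \<in> op_space ?R 2"
    by (simp_all add: r_def m_def free_rho_def free_mu_def op_gen_def free_operad_def lc_basis_def
        eval_nat_numeral)
  have add: "x + y \<in> ?I n" if "x \<in> ?I n" "y \<in> ?I n" for x y n
    using R.ideal_add[OF that] by (simp add: free_operad_sels)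
  have scale: "c \<cdot>\<^sub>k x \<in> ?I n" if "x \<in> ?I n" for c x n
    using R.ideal_scale[OF that] by (simp add: free_operad_sels)
  have diff: "x - y \<in> ?I n" if "x \<in> ?I n" "y \<in> ?I n" for x y n
    using add[OF that(1) scale[OF that(2), of "-1"]] by simp
  have rho: "x \<circ>\<^bsub>i\<^esub> r \<in> ?I 3" if "x \<in> ?I 3" "1 \<le> i" "i \<le> 3" for x i
    using R.ideal_comp_left[OF that(2,3,1) r] by (simp add: free_operad_sels)
  have mE: "m \<circ>\<^bsub>2\<^esub> E \<in> ?I 3"
    using R.ideal_comp_right[OF _ _ m E, of 2] by (simp add: free_operad_sels)
  have Em: "m \<circ>\<^bsub>1\<^esub> E \<in> ?I 3"
    using R.ideal_comp_right[OF _ _ m E, of 1] by (simp add: free_operad_sels)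
  note unfold_rel = expand_quadratic_relation tri_tensor A_def E_def assoc_relation_def
    erb_relation_def r_def m_def free_rho_def free_mu_def op_gen_def tree_comp_linear tree_comp_diff
    lc_basis_comp linear_ext_add linear_ext_scale lc.scale_right_diff_distrib lc.scale_right_distrib
    eval_nat_numeral
  define S where "S = {p. expand_ext (quadratic_relation p) \<in> ?I 3}"
  interpret V: vector_space "pair_scale :: 'k \<Rightarrow> (tri, 'k) tensor_pair \<Rightarrow> _"
    by (rule pair_vector_space)
  have "V.subspace S"
  proof (rule V.subspaceI)
    have "expand_ext (quadratic_relation (0 :: (tri, 'k) tensor_pair)) = 0"
      by (simp add: expand_quadratic_relation)
    with R.ideal_zero[of 3] show "0 \<in> S" by (simp add: S_def free_operad_sels)
  qed (simp_all add: S_def quadratic_relation_add quadratic_relation_scale expand_ext_add expand_ext_scale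
      add scale)
  moreover have "(\<prec>\<^sub>V \<otimes>\<^sub>k \<prec>\<^sub>V, \<prec>\<^sub>V \<otimes>\<^sub>k tri_star lam + kap \<cdot>\<^sub>k (\<bullet>\<^sub>V \<otimes>\<^sub>k \<bullet>\<^sub>V)) \<in> S"
  proof -
    have "(A \<circ>\<^bsub>2\<^esub> r) \<circ>\<^bsub>3\<^esub> r + m \<circ>\<^bsub>2\<^esub> E \<in> ?I 3" by (intro add rho mE A) simp_all
    then show ?thesis by (simp add: S_def unfold_rel algebra_simps)
  qed
  moreover have "(\<succ>\<^sub>V \<otimes>\<^sub>k \<prec>\<^sub>V, \<succ>\<^sub>V \<otimes>\<^sub>k \<prec>\<^sub>V) \<in> S"
  proof -
    have "(A \<circ>\<^bsub>1\<^esub> r) \<circ>\<^bsub>3\<^esub> r \<in> ?I 3" by (intro rho A) simp_all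
    then show ?thesis by (simp add: S_def unfold_rel)
  qed
  moreover have "(tri_star lam \<otimes>\<^sub>k \<succ>\<^sub>V + kap \<cdot>\<^sub>k (\<bullet>\<^sub>V \<otimes>\<^sub>k \<bullet>\<^sub>V), \<succ>\<^sub>V \<otimes>\<^sub>k \<succ>\<^sub>V) \<in> S"
  proof -
    have "(A \<circ>\<^bsub>1\<^esub> r) \<circ>\<^bsub>2\<^esub> r - m \<circ>\<^bsub>1\<^esub> E \<in> ?I 3" by (intro diff rho Em A) simp_all
    then show ?thesis by (simp add: S_def unfold_rel algebra_simps)
  qed
  moreover have "(\<succ>\<^sub>V \<otimes>\<^sub>k \<bullet>\<^sub>V, \<succ>\<^sub>V \<otimes>\<^sub>k \<bullet>\<^sub>V) \<in> S"
    using rho[OF A, of 1] by (simp add: S_def unfold_rel)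
  moreover have "(\<prec>\<^sub>V \<otimes>\<^sub>k \<bullet>\<^sub>V, \<bullet>\<^sub>V \<otimes>\<^sub>k \<succ>\<^sub>V) \<in> S"
    using rho[OF A, of 2] by (simp add: S_def unfold_rel)
  moreover have "(\<bullet>\<^sub>V \<otimes>\<^sub>k \<prec>\<^sub>V, \<bullet>\<^sub>V \<otimes>\<^sub>k \<prec>\<^sub>V) \<in> S"
    using rho[OF A, of 3] by (simp add: S_def unfold_rel)
  moreover have "(\<bullet>\<^sub>V \<otimes>\<^sub>k \<bullet>\<^sub>V, \<bullet>\<^sub>V \<otimes>\<^sub>k \<bullet>\<^sub>V) \<in> S"
    using A by (simp add: S_def unfold_rel)
  ultimately have "Lambda_ETD lam kap \<subseteq> S"
    unfolding Lambda_ETD_def by (intro V.span_minimal) simp_all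
  with assms show ?thesis by (auto simp: S_def)
qed

section \<open>Two ideals containing the Rota-Baxter relations\<close>

definition pairing :: "('b \<Rightarrow> 'k::field) \<Rightarrow> ('b \<Rightarrow>\<^sub>0 'k) \<Rightarrow> 'k" where
  "pairing f x = (\<Sum>b\<in>Poly_Mapping.keys x. Poly_Mapping.lookup x b * f b)"

lemma pairing_eq_linear_ext:
  "pairing f x = Poly_Mapping.lookup (linear_ext (\<lambda>b. f b \<cdot>\<^sub>k lc_basis ()) x) ()"
  by (simp add: pairing_def linear_ext_def lookup_sum lc_basis_def)

lemma pairing_linear:
  "pairing f (x + y) = pairing f x + pairing f y"
  "pairing f (c \<cdot>\<^sub>k x) = c * pairing f x"
  "pairing f (lc_basis b) = f b"
  "pairing f 0 = 0"
  by (simp_all add: pairing_eq_linear_ext linear_ext_add linear_ext_scale lookup_add)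
    (simp add: lc_basis_def)

lemma pairing_diff: "pairing f (x - y) = pairing f x - pairing f y"
  using pairing_linear(1)[of f "x - y" y] by simp

lemma pairing_scale_fun: "pairing (\<lambda>b. c * f b) x = c * pairing f x"
  by (simp add: pairing_def sum_distrib_left mult.left_commute)

lemma pairing_cong:
  "(\<And>b. b \<in> Poly_Mapping.keys x \<Longrightarrow> f b = g b) \<Longrightarrow> pairing f x = pairing g x"
  by (simp add: pairing_def)

lemma pairing_linear_ext: "pairing f (linear_ext g x) = pairing (\<lambda>b. pairing f (g b)) x"
proof -
  have "pairing f (\<Sum>b\<in>A. c b \<cdot>\<^sub>k g b) = (\<Sum>b\<in>A. c b * pairing f (g b))" for A c
    by (induction A rule: infinite_finite_induct) (simp_all add: pairing_linear)
  then show ?thesis by (simp add: linear_ext_def pairing_def[of "\<lambda>b. pairing f (g b)"])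
qed

lemma pairing_swap: "pairing (\<lambda>b. pairing (\<lambda>c. f b c) y) x = pairing (\<lambda>c. pairing (\<lambda>b. f b c) x) y"
  by (simp add: pairing_def sum_distrib_left sum.swap[of _ _ "Poly_Mapping.keys x"] mult.left_commute)

lemma pairing_tree_comp: "pairing f (x \<circ>\<^bsub>i\<^esub> y) = pairing (\<lambda>t. pairing (\<lambda>s. f (graft t i s)) y) x"
  by (simp add: tree_comp_def bilinear_ext_def pairing_linear_ext pairing_linear)

text \<open>
  The side tells where \<open>\<rho>\<close> puts the factor \<open>a\<close>: on the left of its argument, where it adds to the
  exponent in front of the first leaf, or on the right, where it adds to the exponent behind the last leaf.
\<close>

datatype side = Leftmost | Rightmost

fun bump :: "side \<Rightarrow> nat list \<Rightarrow> nat list" where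
  "bump _ [] = []"
| "bump Leftmost (k # ks) = Suc k # ks"
| "bump Rightmost (k # ks) = butlast (k # ks) @ [Suc (last (k # ks))]"

fun exponents :: "side \<Rightarrow> rb tree \<Rightarrow> nat list" where
  "exponents c Leaf = [0]"
| "exponents c (Node g ts) = (if g = Rho then bump c else id) (concat (map (exponents c) ts))"

text \<open>
  The exponents of a grafted tree: the factor \<open>a\<^bsup>k\<^esup>\<close> next to the replaced leaf becomes a factor next
  to the whole word inserted there, so it is absorbed into the first or the last exponent of that word.
\<close>

definition insert_exps :: "side \<Rightarrow> nat list \<Rightarrow> nat \<Rightarrow> nat list \<Rightarrow> nat list" where
  "insert_exps c e i l = take (i - 1) e @ (bump c ^^ (e ! (i - 1))) l @ drop i e"

lemma bump_Rightmost: "l \<noteq> [] \<Longrightarrow> bump Rightmost l = butlast l @ [Suc (last l)]"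
  by (cases l) auto

lemma length_bump [simp]: "length (bump c l) = length l"
  by (cases "(c, l)" rule: bump.cases) auto

lemma length_bump_pow [simp]: "length ((bump c ^^ k) l) = length l"
  by (induction k) auto

lemma bump_eq_Nil [simp]: "bump c l = [] \<longleftrightarrow> l = []"
  using length_bump[of c l] by (metis length_0_conv)

lemma bump_pow_eq_Nil [simp]: "(bump c ^^ k) l = [] \<longleftrightarrow> l = []"
  by (induction k) auto

lemma bump_append:
  "l \<noteq> [] \<Longrightarrow> bump Leftmost (l @ r) = bump Leftmost l @ r"
  "l \<noteq> [] \<Longrightarrow> bump Rightmost (r @ l) = r @ bump Rightmost l"
  by (cases l) (auto simp: bump_Rightmost butlast_append)

lemma bump_insert_exps:
  assumes "1 \<le> i" "i \<le> length e" "l \<noteq> []"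
  shows "bump c (insert_exps c e i l) = insert_exps c (bump c e) i l"
proof -
  define xs k ys where "xs = take (i - 1) e" and "k = e ! (i - 1)" and "ys = drop i e"
  have e: "e = xs @ k # ys" and i: "i = Suc (length xs)"
    using assms id_take_nth_drop[of "i - 1" e] by (simp_all add: xs_def k_def ys_def)
  have ins: "insert_exps c (as @ j # bs) (Suc (length as)) l = as @ (bump c ^^ j) l @ bs" for as j bs
    by (simp add: insert_exps_def)
  show ?thesis
  proof (cases c)
    case Leftmost
    show ?thesis
    proof (cases xs)
      case Nil
      with Leftmost ins[of "[]"] show ?thesis unfolding e i by (simp add: bump_append assms)
    next
      case (Cons a as)
      with Leftmost ins[of "a # as"] ins[of "Suc a # as"] show ?thesis unfolding e i by simp
    qed
  next
    case Rightmost
    show ?thesis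
    proof (cases "ys = []")
      case True
      with Rightmost ins[of xs _ "[]"] show ?thesis
        unfolding e i by (simp add: bump_append assms)
    next
      case False
      then have "bump c (xs @ (bump c ^^ k) l @ ys) = xs @ (bump c ^^ k) l @ bump c ys"
        "bump c (xs @ k # ys) = xs @ k # bump c ys"
        using Rightmost bump_append(2)[of ys "xs @ (bump c ^^ k) l"] bump_append(2)[of ys "xs @ [k]"]
        by simp_all
      then show ?thesis unfolding e i by (simp add: ins)
    qed
  qed
qed

lemma length_exponents: "length (exponents c t) = leaves t"
proof (induction t)
  case (Node g ts)
  then show ?case by (simp add: length_concat comp_def cong: map_cong)
qed simp

lemma length_concat_exponents: "length (concat (map (exponents c) ts)) = sum_list (map leaves ts)"
  by (induction ts) (simp_all add: length_exponents)

lemma exponents_graft: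
  assumes "exponents c s \<noteq> []"
  shows "1 \<le> i \<Longrightarrow> i \<le> leaves t
      \<Longrightarrow> exponents c (graft t i s) = insert_exps c (exponents c t) i (exponents c s)"
    and "1 \<le> i \<Longrightarrow> i \<le> sum_list (map leaves ts)
      \<Longrightarrow> concat (map (exponents c) (graft_list ts i s))
        = insert_exps c (concat (map (exponents c) ts)) i (exponents c s)"
  using assms
proof (induction t i s and ts i s rule: graft_graft_list.induct)
  case (1 i s)
  then show ?case by (simp add: insert_exps_def)
next
  case (2 g ts i s)
  then show ?case by (simp add: bump_insert_exps length_concat_exponents)
next
  case (4 t ts i s)
  then show ?case
    by (auto simp: insert_exps_def length_exponents nth_append)
qed simp

text \<open>The pure tensor of linear forms on \<open>k[a]\<close>, evaluated at a tensor product of powers of \<open>a\<close>.\<close>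

definition weight :: "(nat \<Rightarrow> 'k::field) list \<Rightarrow> nat list \<Rightarrow> 'k" where
  "weight fs e = prod_list (map2 (\<lambda>f k. f k) fs e)"

definition recurrent :: "'k::field \<Rightarrow> 'k \<Rightarrow> (nat \<Rightarrow> 'k) \<Rightarrow> bool" where
  "recurrent lam kap f \<longleftrightarrow> (\<forall>k. f (Suc (Suc k)) = - lam * f (Suc k) - kap * f k)"

lemma weight_Cons [simp]: "weight (f # fs) (k # e) = f k * weight fs e"
  and weight_Nil [simp]: "weight [] e = 1"
  by (simp_all add: weight_def)

lemma weight_append:
  "length fs = length e \<Longrightarrow> weight (fs @ gs) (e @ e') = weight fs e * weight gs e'"
  by (induction fs e rule: list_induct2) simp_all

lemma recurrent_shift: "recurrent lam kap f \<Longrightarrow> recurrent lam kap (\<lambda>k. f (j + k))"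
  by (simp add: recurrent_def)

lemma recurrent_scale: "recurrent lam kap f \<Longrightarrow> recurrent lam kap (\<lambda>k. a * f k)"
  unfolding recurrent_def by (auto simp: right_diff_distrib mult.left_commute)

lemma bump_pow_Leftmost: "(bump Leftmost ^^ k) (a # l) = (a + k) # l"
  by (induction k) simp_all

lemma bump_pow_Rightmost: "(bump Rightmost ^^ k) (l @ [a]) = l @ [a + k]"
  by (induction k) (simp_all add: bump_append)

text \<open>
  The next two lemmas view \<open>a\<^bsup>k\<^esup>\<close> times a word from its two sides. For a fixed word, the value is
  a linear form in \<open>a\<^bsup>k\<^esup>\<close>; for a fixed \<open>k\<close>, multiplication by \<open>a\<^bsup>k\<^esup>\<close> followed by a product of
  linear forms is again a product of linear forms. The first view shows that grafting a tree onto an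
  identity of the model gives an identity, the second that grafting an identity onto a tree does.
\<close>

lemma weight_bump_pow_recurrent:
  assumes "length fs = length e" "e \<noteq> []" "\<forall>f\<in>set fs. recurrent lam kap f"
  shows "recurrent lam kap (\<lambda>k. weight fs ((bump c ^^ k) e))"
proof (cases c)
  case Leftmost
  from assms obtain a l f gs where "e = a # l" "fs = f # gs" by (metis length_0_conv neq_Nil_conv)
  with assms(3) Leftmost show ?thesis
    using recurrent_scale[OF recurrent_shift, of lam kap f "weight gs l" a]
    by (simp add: bump_pow_Leftmost mult.commute)
next
  case Rightmost
  from assms obtain a l f gs where *: "e = l @ [a]" "fs = gs @ [f]"
    by (metis length_0_conv rev_exhaust)
  with assms have "length gs = length l" by simp
  with assms(3) Rightmost * show ?thesis
    using recurrent_scale[OF recurrent_shift, of lam kap f "weight gs l" a]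
    by (simp add: bump_pow_Rightmost weight_append)
qed

lemma weight_bump_pow_shift:
  assumes "length fs = n" "n \<noteq> 0" "\<forall>f\<in>set fs. recurrent lam kap f"
  obtains gs where "length gs = n" "\<forall>f\<in>set gs. recurrent lam kap f"
    "\<And>e. length e = n \<Longrightarrow> weight fs ((bump c ^^ k) e) = weight gs e"
proof (cases c)
  case Leftmost
  from assms obtain f hs where fs: "fs = f # hs" by (metis length_0_conv neq_Nil_conv)
  show ?thesis
  proof (rule that[of "(\<lambda>j. f (k + j)) # hs"])
    show "weight fs ((bump c ^^ k) e) = weight ((\<lambda>j. f (k + j)) # hs) e" if "length e = n" for e
      using that assms Leftmost by (cases e) (simp_all add: fs bump_pow_Leftmost add.commute)
  qed (use assms in \<open>auto simp: fs recurrent_shift\<close>)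
next
  case Rightmost
  from assms obtain f hs where fs: "fs = hs @ [f]" by (metis length_0_conv rev_exhaust)
  show ?thesis
  proof (rule that[of "hs @ [\<lambda>j. f (k + j)]"])
    show "weight fs ((bump c ^^ k) e) = weight (hs @ [\<lambda>j. f (k + j)]) e" if "length e = n" for e
      using that assms Rightmost
      by (cases e rule: rev_cases) (simp_all add: fs bump_pow_Rightmost weight_append add.commute)
  qed (use assms in \<open>auto simp: fs recurrent_shift\<close>)
qed

text \<open>The identities of the model in which \<open>\<rho>\<close> is multiplication by \<open>a\<close> on the given side.\<close>

definition weight_kernel :: "side \<Rightarrow> 'k::field \<Rightarrow> 'k \<Rightarrow> nat \<Rightarrow> (rb tree \<Rightarrow>\<^sub>0 'k) set" where
  "weight_kernel c lam kap n = {x \<in> op_space (free_operad rb_arity) n.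
     \<forall>fs. length fs = n \<and> (\<forall>f\<in>set fs. recurrent lam kap f)
       \<longrightarrow> pairing (\<lambda>t. weight fs (exponents c t)) x = 0}"

lemma leaves_rb_pos: "wf_tree rb_arity t \<Longrightarrow> leaves t \<noteq> 0"
proof (induction t)
  case (Node g ts)
  then have "ts \<noteq> []" by (cases g) auto
  with Node show ?case by (cases ts) auto
qed simp

lemma weight_graft:
  assumes "wf_tree rb_arity t" "leaves t = m" "wf_tree rb_arity s" "leaves s = n"
    and "length fs = m + n - 1" "1 \<le> i" "i \<le> m"
  shows "weight fs (exponents c (graft t i s))
    = weight (take (i - 1) fs) (take (i - 1) (exponents c t))
    * weight (take n (drop (i - 1) fs)) ((bump c ^^ (exponents c t ! (i - 1))) (exponents c s))
    * weight (drop (i - 1 + n) fs) (drop i (exponents c t))"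
proof -
  define as bs gs where "as = take (i - 1) fs" and "bs = take n (drop (i - 1) fs)"
    and "gs = drop (i - 1 + n) fs"
  have fs: "fs = as @ bs @ gs"
    by (simp add: as_def bs_def gs_def) (metis add.commute append_take_drop_id drop_drop)
  have "exponents c s \<noteq> []"
    using assms leaves_rb_pos[of s] length_exponents[of c s] by auto
  then have "exponents c (graft t i s) = insert_exps c (exponents c t) i (exponents c s)"
    using assms by (simp add: exponents_graft)
  moreover have "length as = length (take (i - 1) (exponents c t))"
    "length bs = length ((bump c ^^ (exponents c t ! (i - 1))) (exponents c s))"
    using assms by (auto simp: as_def bs_def length_exponents)
  ultimately have "weight fs (exponents c (graft t i s))
      = weight as (take (i - 1) (exponents c t))
      * weight bs ((bump c ^^ (exponents c t ! (i - 1))) (exponents c s)) * weight gs (drop i (exponents c t))"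
    by (simp add: fs insert_exps_def weight_append mult.assoc)
  then show ?thesis by (simp only: as_def bs_def gs_def)
qed

text \<open>
  The weight of a grafted tree is a weight of the outer tree when the inner one is fixed, and up to a
  constant a weight of the inner tree when the outer one is fixed; so a combination of
  trees that all weights kill stays so when a tree is grafted onto it or when it is grafted onto a tree.
\<close>

lemma operad_ideal_weight_kernel:
  fixes lam kap :: "'k::field"
  shows "operad_ideal (free_operad rb_arity) (weight_kernel c lam kap)"
proof -
  let ?R = "free_operad rb_arity :: ('k, rb tree \<Rightarrow>\<^sub>0 'k) operad" and ?I = "weight_kernel c lam kap"
  interpret R: ns_operad ?R by (rule ns_operad_free)
  have left: "op_comp ?R m n i x y \<in> ?I (m + n - 1)"
    if i: "1 \<le> i" "i \<le> m" and x: "x \<in> ?I m" and y: "y \<in> op_space ?R n" for m n i x y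
  proof -
    have "pairing (\<lambda>t. weight fs (exponents c t)) (x \<circ>\<^bsub>i\<^esub> y) = 0"
      if fs: "length fs = m + n - 1" "\<forall>f\<in>set fs. recurrent lam kap f" for fs
    proof -
      have "pairing (\<lambda>t. weight fs (exponents c (graft t i s))) x = 0"
        if s: "s \<in> Poly_Mapping.keys y" for s
      proof -
        from s y have wf_s: "wf_tree rb_arity s" "leaves s = n" by (auto simp: free_operad_def)
        then have n: "n \<noteq> 0" using leaves_rb_pos by blast
        define bs where "bs = take n (drop (i - 1) fs)"
        \<comment> \<open>As a function of the exponent of the leaf of \<open>t\<close> that \<open>s\<close> replaces, the weight is
          again a recurrent sequence.\<close>
        define \<chi> where "\<chi> k = weight bs ((bump c ^^ k) (exponents c s))" for k
        define hs where "hs = take (i - 1) fs @ \<chi> # drop (i - 1 + n) fs"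
        have bs: "length bs = length (exponents c s)" "exponents c s \<noteq> []"
          using fs i n wf_s length_exponents[of c s] by (auto simp: bs_def)
        have "set bs \<subseteq> set fs"
          unfolding bs_def by (meson set_drop_subset set_take_subset subset_trans)
        then have "recurrent lam kap (\<lambda>k. weight bs ((bump c ^^ k) (exponents c s)))"
          using bs fs(2) by (intro weight_bump_pow_recurrent) auto
        then have "\<forall>f\<in>set hs. recurrent lam kap f" "length hs = m"
          using fs i n unfolding hs_def \<chi>_def by (auto dest: in_set_takeD in_set_dropD)
        with x have "pairing (\<lambda>t. weight hs (exponents c t)) x = 0"
          by (simp add: weight_kernel_def)
        also have "pairing (\<lambda>t. weight hs (exponents c t)) x
            = pairing (\<lambda>t. weight fs (exponents c (graft t i s))) x"
        proof (rule pairing_cong)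
          fix t assume "t \<in> Poly_Mapping.keys x"
          with x have wf_t: "wf_tree rb_arity t" "leaves t = m"
            by (auto simp: weight_kernel_def free_operad_def)
          let ?e = "exponents c t"
          have e: "?e = take (i - 1) ?e @ ?e ! (i - 1) # drop i ?e"
            using id_take_nth_drop[of "i - 1" ?e] wf_t i by (simp add: length_exponents)
          have "length (take (i - 1) fs) = length (take (i - 1) ?e)"
            using wf_t i n fs by (auto simp: length_exponents)
          then have "weight hs ?e = weight (take (i - 1) fs) (take (i - 1) ?e)
              * (\<chi> (?e ! (i - 1)) * weight (drop (i - 1 + n) fs) (drop i ?e))"
            unfolding hs_def by (subst e) (simp only: weight_append weight_Cons)
          then show "weight hs ?e = weight fs (exponents c (graft t i s))"
            by (simp add: weight_graft[OF wf_t wf_s fs(1) i] \<chi>_def bs_def)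
        qed
        finally show ?thesis .
      qed
      then have "pairing (\<lambda>s. pairing (\<lambda>t. weight fs (exponents c (graft t i s))) x) y = 0"
        by (simp add: pairing_def[of _ y])
      then show ?thesis by (simp add: pairing_tree_comp pairing_swap[of _ y x])
    qed
    moreover have "op_comp ?R m n i x y \<in> op_space ?R (m + n - 1)"
      using x y i by (intro R.comp_closed) (simp_all add: weight_kernel_def)
    ultimately show ?thesis by (simp add: weight_kernel_def free_operad_sels)
  qed
  have right: "op_comp ?R m n i x y \<in> ?I (m + n - 1)"
    if i: "1 \<le> i" "i \<le> m" and x: "x \<in> op_space ?R m" and y: "y \<in> ?I n" for m n i x y
  proof -
    have "pairing (\<lambda>t. weight fs (exponents c t)) (x \<circ>\<^bsub>i\<^esub> y) = 0"
      if fs: "length fs = m + n - 1" "\<forall>f\<in>set fs. recurrent lam kap f" for fs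
    proof -
      have "pairing (\<lambda>s. weight fs (exponents c (graft t i s))) y = 0"
        if t: "t \<in> Poly_Mapping.keys x" for t
      proof (cases "n = 0")
        case True
        with y leaves_rb_pos have "t \<notin> Poly_Mapping.keys y" for t
          by (fastforce simp: weight_kernel_def free_operad_def)
        then have "Poly_Mapping.keys y = {}" by blast
        then show ?thesis by (simp add: pairing_def)
      next
        case False
        from t x have wf_t: "wf_tree rb_arity t" "leaves t = m" by (auto simp: free_operad_def)
        let ?e = "exponents c t"
        let ?A = "weight (take (i - 1) fs) (take (i - 1) ?e) * weight (drop (i - 1 + n) fs) (drop i ?e)"
        have "length (take n (drop (i - 1) fs)) = n"
          "\<forall>f\<in>set (take n (drop (i - 1) fs)). recurrent lam kap f"
          using fs i by (auto dest!: in_set_takeD in_set_dropD)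
        from weight_bump_pow_shift[OF this(1) False this(2), where c = c and k = "?e ! (i - 1)"]
        obtain gs where gs: "length gs = n" "\<forall>f\<in>set gs. recurrent lam kap f"
          "\<And>e. length e = n \<Longrightarrow>
            weight (take n (drop (i - 1) fs)) ((bump c ^^ (?e ! (i - 1))) e) = weight gs e"
          by blast
        have "pairing (\<lambda>s. weight fs (exponents c (graft t i s))) y
            = pairing (\<lambda>s. ?A * weight gs (exponents c s)) y"
        proof (rule pairing_cong)
          fix s assume "s \<in> Poly_Mapping.keys y"
          with y have wf_s: "wf_tree rb_arity s" "leaves s = n"
            by (auto simp: weight_kernel_def free_operad_def)
          then show "weight fs (exponents c (graft t i s)) = ?A * weight gs (exponents c s)"
            using gs(3)[of "exponents c s"]
            by (simp add: weight_graft[OF wf_t wf_s fs(1) i] length_exponents)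
        qed
        also have "\<dots> = 0"
          using y gs(1,2) by (simp add: pairing_scale_fun weight_kernel_def)
        finally show ?thesis .
      qed
      then show ?thesis by (simp add: pairing_tree_comp pairing_def[of _ x])
    qed
    moreover have "op_comp ?R m n i x y \<in> op_space ?R (m + n - 1)"
      using x y i by (intro R.comp_closed) (simp_all add: weight_kernel_def)
    ultimately show ?thesis by (simp add: weight_kernel_def free_operad_sels)
  qed
  show ?thesis
    unfolding operad_ideal_def
  proof (intro conjI allI ballI impI)
    fix n a and x y :: "rb tree \<Rightarrow>\<^sub>0 'k"
    show "?I n \<subseteq> op_space ?R n" by (auto simp: weight_kernel_def)
    show "op_zero ?R n \<in> ?I n"
      using R.zero_closed[of n] by (simp add: weight_kernel_def free_operad_sels pairing_linear)
    assume x: "x \<in> ?I n"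
    then show "op_scale ?R n a x \<in> ?I n"
      using R.scale_closed[of x n a] by (simp add: weight_kernel_def free_operad_sels pairing_linear)
    assume "y \<in> ?I n"
    with x show "op_add ?R n x y \<in> ?I n"
      using R.add_closed[of x n y] by (simp add: weight_kernel_def free_operad_sels pairing_linear)
  qed (use left right in blast)+
qed

lemma ERB_relations_in_weight_kernel:
  fixes lam kap :: "'k::field"
  shows "assoc_relation \<in> weight_kernel c lam kap 3"
    and "erb_relation lam kap \<in> weight_kernel c lam kap 2"
proof -
  note unfold_rel = assoc_relation_def erb_relation_def free_rho_def free_mu_def op_gen_def
    lc_basis_comp pairing_linear pairing_diff eval_nat_numeral
  show "assoc_relation \<in> weight_kernel c lam kap 3"
    using erb_relations_closed(1)[where 'a = 'k] by (simp add: weight_kernel_def unfold_rel)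
  have "pairing (\<lambda>t. weight fs (exponents c t)) (erb_relation lam kap) = 0"
    if fs: "length fs = 2" "\<forall>f\<in>set fs. recurrent lam kap f" for fs
  proof -
    from fs(1) obtain f g where fg: "fs = [f, g]" by (auto simp: eval_nat_numeral length_Suc_conv)
    with fs(2) have rec: "f (Suc (Suc 0)) = - lam * f (Suc 0) - kap * f 0"
      "g (Suc (Suc 0)) = - lam * g (Suc 0) - kap * g 0"
      by (simp_all add: recurrent_def)
    show ?thesis
      by (cases c) (simp_all add: fg unfold_rel rec algebra_simps)
  qed
  then show "erb_relation lam kap \<in> weight_kernel c lam kap 2"
    using erb_relations_closed(2) by (simp add: weight_kernel_def)
qed

lemma ERB_ideal_subset_weight_kernel: "ERB_ideal lam kap n \<subseteq> weight_kernel c lam kap n"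
proof
  fix x assume "x \<in> ERB_ideal lam kap n"
  moreover have "(if m = 3 then {assoc_relation} else if m = 2 then {erb_relation lam kap} else {})
      \<subseteq> weight_kernel c lam kap m" for m
    using ERB_relations_in_weight_kernel[where lam = lam and kap = kap and c = c] by simp
  ultimately show "x \<in> weight_kernel c lam kap n"
    using operad_ideal_weight_kernel[where lam = lam and kap = kap and c = c] unfolding ERB_ideal_def generated_ideal_iff by blast
qed

section \<open>No further relations in arity three\<close>

text \<open>
  The initial values \<open>(1, 0)\<close> and \<open>(0, 1)\<close> give the linear forms dual to the basis \<open>1, a\<close> of
  \<open>k[a] / (a\<^sup>2 + \<lambda> a + \<kappa>)\<close>.
\<close>

fun rec_seq :: "'k::field \<Rightarrow> 'k \<Rightarrow> 'k \<Rightarrow> 'k \<Rightarrow> nat \<Rightarrow> 'k" where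
  "rec_seq lam kap a b 0 = a"
| "rec_seq lam kap a b (Suc 0) = b"
| "rec_seq lam kap a b (Suc (Suc k)) = - lam * rec_seq lam kap a b (Suc k) - kap * rec_seq lam kap a b k"

lemma recurrent_rec_seq: "recurrent lam kap (rec_seq lam kap a b)"
  by (simp add: recurrent_def)

lemma pairing_tri_pairs:
  "pairing f x = (\<Sum>a\<in>{Prec, Succ, Bullet}. \<Sum>b\<in>{Prec, Succ, Bullet}. Poly_Mapping.lookup x (a, b) * f (a, b))"
proof -
  let ?T = "{Prec, Succ, Bullet}"
  have "a \<in> ?T" for a by (cases a) simp_all
  then have "p \<in> ?T \<times> ?T" for p by (simp only: mem_Times_iff simp_thms)
  then have "Poly_Mapping.keys x \<subseteq> ?T \<times> ?T" by blast
  then have "pairing f x = (\<Sum>p\<in>?T \<times> ?T. Poly_Mapping.lookup x p * f p)"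
    unfolding pairing_def by (intro sum.mono_neutral_left) (simp_all add: in_keys_iff)
  also have "\<dots> = (\<Sum>a\<in>?T. \<Sum>b\<in>?T. Poly_Mapping.lookup x (a, b) * f (a, b))"
    by (subst sum.cartesian_product) (simp only: case_prod_unfold prod.collapse)
  finally show ?thesis .
qed

text \<open>
  A relation \<open>(P, Q)\<close> has nine coefficients on each side. Reading off the coefficients of suitable words
  \<open>a\<^bsup>i\<^esup> x a\<^bsup>j\<^esup> y a\<^bsup>k\<^esup> z\<close> and \<open>x a\<^bsup>i\<^esup> y a\<^bsup>j\<^esup> z a\<^bsup>k\<^esup>\<close> with exponents 0 and 1 in the two models expresses \<open>Q\<close>
  and two of the coefficients of \<open>P\<close> through the remaining seven coefficients of \<open>P\<close>.
\<close>

lemma ERB_ideal_imp_Lambda_ETD: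
  fixes lam kap :: "'k::field" and p :: "(tri, 'k) tensor_pair"
  assumes "expand_ext (quadratic_relation p) \<in> ERB_ideal lam kap 3"
  shows "p \<in> Lambda_ETD lam kap"
proof -
  define P where "P a b = Poly_Mapping.lookup (fst p) (a, b)" for a b
  define Q where "Q a b = Poly_Mapping.lookup (snd p) (a, b)" for a b
  let ?x = "expand_ext (quadratic_relation p)"
  have zero: "pairing (\<lambda>t. weight [rec_seq lam kap a a', rec_seq lam kap b b', rec_seq lam kap d d'] (exponents c t)) ?x = 0"
    for a a' b b' d d' c
    using assms ERB_ideal_subset_weight_kernel[where n = 3 and lam = lam and kap = kap and c = c]
    by (auto simp: weight_kernel_def recurrent_rec_seq)
  note expand_zero = expand_quadratic_relation pairing_diff pairing_linear_ext pairing_linear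
    pairing_tri_pairs P_def[symmetric] Q_def[symmetric] eval_nat_numeral
  \<comment> \<open>The words \<open>x a y a z\<close>, \<open>a x y a z\<close>, \<open>x y a z\<close>, \<open>a x a y z\<close>, \<open>x a y z\<close>, \<open>x y z\<close>, in this order;
    a square of \<open>a\<close> arises from \<open>R(R(x) y) z\<close> and from \<open>x R(R(y) z)\<close>.\<close>
  have left: "P Prec Prec = Q Prec Prec" "P Succ Prec = Q Succ Prec" "P Bullet Prec = Q Bullet Prec"
    "P Prec Succ = Q Succ Succ" "P Prec Bullet = - lam * Q Prec Succ + Q Prec Bullet + Q Bullet Succ"
    "- kap * P Succ Succ + P Bullet Bullet = - kap * Q Prec Succ + Q Bullet Bullet"
    using zero[of 1 0 0 1 0 1 Leftmost] zero[of 0 1 1 0 0 1 Leftmost] zero[of 1 0 1 0 0 1 Leftmost]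
      zero[of 0 1 0 1 1 0 Leftmost] zero[of 1 0 0 1 1 0 Leftmost] zero[of 1 0 1 0 1 0 Leftmost]
    by (simp_all add: expand_zero algebra_simps)
  \<comment> \<open>The words \<open>x y a z a\<close>, \<open>x a y a z\<close>, \<open>x a y z\<close>, \<open>x y z a\<close>, \<open>x y a z\<close>, in this order;
    a square of \<open>a\<close> arises from \<open>R(x R(y)) z\<close> and from \<open>x R(y R(z))\<close>.\<close>
  have right: "P Prec Prec = Q Prec Succ" "P Succ Succ = Q Succ Succ" "P Succ Bullet = Q Succ Bullet"
    "P Bullet Prec = - lam * Q Prec Prec + Q Prec Bullet + Q Bullet Prec"
    "- lam * P Prec Succ + P Bullet Succ + P Prec Bullet = Q Bullet Succ"
    using zero[of 1 0 0 1 0 1 Rightmost] zero[of 0 1 0 1 1 0 Rightmost] zero[of 0 1 1 0 1 0 Rightmost]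
      zero[of 1 0 1 0 0 1 Rightmost] zero[of 1 0 0 1 1 0 Rightmost]
    by (simp_all add: expand_zero algebra_simps)
  interpret V: vector_space "pair_scale :: 'k \<Rightarrow> (tri, 'k) tensor_pair \<Rightarrow> _"
    by (rule pair_vector_space)
  \<comment> \<open>Each multiplier is the coefficient in \<open>P\<close> of a monomial that occurs on the left of one of the seven
    relations only; the last one is corrected because \<open>\<bullet> \<otimes> \<bullet>\<close> occurs also on the left of the third.\<close>
  have "p = pair_scale (P Prec Prec) (\<prec>\<^sub>V \<otimes>\<^sub>k \<prec>\<^sub>V, \<prec>\<^sub>V \<otimes>\<^sub>k tri_star lam + kap \<cdot>\<^sub>k (\<bullet>\<^sub>V \<otimes>\<^sub>k \<bullet>\<^sub>V))
      + pair_scale (P Succ Prec) (\<succ>\<^sub>V \<otimes>\<^sub>k \<prec>\<^sub>V, \<succ>\<^sub>V \<otimes>\<^sub>k \<prec>\<^sub>V)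
      + pair_scale (P Succ Succ) (tri_star lam \<otimes>\<^sub>k \<succ>\<^sub>V + kap \<cdot>\<^sub>k (\<bullet>\<^sub>V \<otimes>\<^sub>k \<bullet>\<^sub>V), \<succ>\<^sub>V \<otimes>\<^sub>k \<succ>\<^sub>V)
      + pair_scale (P Succ Bullet) (\<succ>\<^sub>V \<otimes>\<^sub>k \<bullet>\<^sub>V, \<succ>\<^sub>V \<otimes>\<^sub>k \<bullet>\<^sub>V)
      + pair_scale (P Prec Bullet) (\<prec>\<^sub>V \<otimes>\<^sub>k \<bullet>\<^sub>V, \<bullet>\<^sub>V \<otimes>\<^sub>k \<succ>\<^sub>V)
      + pair_scale (P Bullet Prec) (\<bullet>\<^sub>V \<otimes>\<^sub>k \<prec>\<^sub>V, \<bullet>\<^sub>V \<otimes>\<^sub>k \<prec>\<^sub>V)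
      + pair_scale (P Bullet Bullet - kap * P Succ Succ) (\<bullet>\<^sub>V \<otimes>\<^sub>k \<bullet>\<^sub>V, \<bullet>\<^sub>V \<otimes>\<^sub>k \<bullet>\<^sub>V)" (is "_ = ?q")
  proof -
    have P: "Poly_Mapping.lookup (fst ?q) (a, b) = P a b" for a b
      using left right
      by (cases a; cases b)
        (simp_all add: pair_scale_def tri_tensor lookup_add lookup_minus lookup_lc_basis algebra_simps)
    have Q: "Poly_Mapping.lookup (snd ?q) (a, b) = Q a b" for a b
      using left right
      by (cases a; cases b)
        (simp_all add: pair_scale_def tri_tensor lookup_add lookup_minus lookup_lc_basis algebra_simps)
    show ?thesis
    proof (rule prod_eqI; rule poly_mapping_eqI)
      fix ab :: "tri \<times> tri"
      show "Poly_Mapping.lookup (fst p) ab = Poly_Mapping.lookup (fst ?q) ab"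
        using P[of "fst ab" "snd ab"] by (simp only: P_def prod.collapse)
      show "Poly_Mapping.lookup (snd p) ab = Poly_Mapping.lookup (snd ?q) ab"
        using Q[of "fst ab" "snd ab"] by (simp only: Q_def prod.collapse)
    qed
  qed
  then show ?thesis
    unfolding Lambda_ETD_def by (elim ssubst) (intro V.span_add V.span_scale V.span_base; simp)
qed

theorem theorem4p6:
  fixes lam kap :: "'k::field_char_0"
  shows "ETD lam kap = tri_companion (ERB lam kap) (ERB_rho lam kap) (ERB_mu lam kap) \<and>
    (\<exists>!\<Phi>. is_tri_hom (ERB lam kap) (ERB_rho lam kap) (ERB_mu lam kap) \<Phi>) \<and>
    (\<forall>\<Phi>. is_tri_hom (ERB lam kap) (ERB_rho lam kap) (ERB_mu lam kap) \<Phi> \<longrightarrow>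
      operad_kernel free_binary (ERB lam kap) \<Phi> 3 \<inter> range quadratic_relation = quadratic_relation ` Lambda_ETD lam kap)"
proof -
  let ?hom = "is_tri_hom (ERB lam kap) (ERB_rho lam kap) (ERB_mu lam kap)"
  have unique: "\<Phi> = tri_to_ERB lam kap" if "?hom \<Phi>" for \<Phi>
  proof (rule free_binary_hom_eqI[OF ns_operad_ERB[of lam kap]])
    note both = that is_tri_hom_tri_to_ERB[of lam kap]
    show "\<Phi> \<in> operad_hom free_binary (ERB lam kap)"
      "tri_to_ERB lam kap \<in> operad_hom free_binary (ERB lam kap)"
      using both unfolding is_tri_hom_def by blast+
    show "\<Phi> 2 (bin_gen g) = tri_to_ERB lam kap 2 (bin_gen g)" for g
      using both unfolding is_tri_hom_def by (cases g) simp_all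
  qed
  then have ex1: "\<exists>!\<Phi>. ?hom \<Phi>" using is_tri_hom_tri_to_ERB by blast
  have kernel: "operad_kernel free_binary (ERB lam kap) (tri_to_ERB lam kap) 3 \<inter> range quadratic_relation
      = quadratic_relation ` Lambda_ETD lam kap"
    unfolding set_eq_iff Int_iff tri_to_ERB_kernel_iff
    using Lambda_ETD_in_ERB_ideal ERB_ideal_imp_Lambda_ETD quadratic_relation_closed by blast
  have "tri_hom (ERB lam kap) (ERB_rho lam kap) (ERB_mu lam kap) = tri_to_ERB lam kap"
    unfolding tri_hom_def by (rule the1_equality, rule ex1, rule is_tri_hom_tri_to_ERB)
  with kernel have "ETD lam kap = tri_companion (ERB lam kap) (ERB_rho lam kap) (ERB_mu lam kap)"
    by (simp add: ETD_def quadratic_operad_def tri_companion_def)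
  with ex1 kernel unique show ?thesis by blast
qed

end
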